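(* Let $\Gamma$ be any 2-agent zero-sum game in which all entries of $A=A^{(12)}$ are distinct, and let $\bar X^T=\frac1T\sum_{t=1}^T X^t$ where $X^t$ is generated by Stochastic MWU. There exists $\eta_0>0$ such that for all learning rates $\eta<\eta_0$: (1) the sequence $\{\bar X^t\}_{t=1}^\infty$ has a convergent subsequence; (2) every convergent subsequence of $\{\bar X^t\}_{t=1}^\infty$ converges to a mixture of pure strategies, i.e., to a probability distribution supported on pure strategy profiles.
   Context: Two agents with finite pure strategy sets $\mathcal{S}_1,\mathcal{S}_2$ and simplices $\mathcal{X}_i$ of mixed strategies, $\mathcal{X}=\mathcal{X}_1\times\mathcal{X}_2$; $A^{(12)}=A$, $A^{(21)}=-A^\top$, agent $i$'s expected payoff is $\langle x_i,A^{(ij)}x_j\rangle$. Stochastic MWU with learning rate $\eta$ (used by both agents): given $X^t$, each agent $j$ independently samples a pure strategy $s_j$ with probability $X^t_{js_j}$, and then $X^{t+1}_{i\hat s}=\dfrac{X^t_{i\hat s}\exp(\eta\langle e_{\hat s},A^{(ij)}e_{s_j}\rangle)}{\sum_{\bar s\in\mathcal{S}_i}X^t_{i\bar s}\exp(\eta\langle e_{\bar s},A^{(ij)}e_{s_j}\rangle)}$ for $i\ne j$ (with $0/0=0$). Here $X^t$ is a random element of $\mathcal{X}$ and $\bar X^T$ is understood as the time-average of the laws (distributions on $\mathcal{X}$) of $X^1,\dots,X^T$, with convergence meaning weak convergence of probability measures on $\mathcal{X}$. *)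

theory Defs
  imports "HOL-Probability.Probability"
begin

text \<open>Pure strategy sets are the finite types 'a (agent 1) and 'b (agent 2).
  Mixed strategies are probability vectors in real^'a and real^'b.
  The payoff matrix A = A^(12) is given by its entries A s1 s2;
  A^(21) = -A^T.\<close>

type_synonym ('a, 'b) profile = "(real^'a) \<times> (real^'b)"

definition mixed_strats :: "(real^'a::finite) set" where
  "mixed_strats = {x. (\<forall>s. 0 \<le> x $ s) \<and> (\<Sum>s\<in>UNIV. x $ s) = 1}"

definition profiles :: "('a::finite, 'b::finite) profile set" where
  "profiles = mixed_strats \<times> mixed_strats"

definition pure_profiles :: "('a::finite, 'b::finite) profile set" where
  "pure_profiles = {(axis s1 1, axis s2 1) | s1 s2. True}"

definition mixed_pmf :: "real^'a::finite \<Rightarrow> 'a pmf" where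
  "mixed_pmf x = embed_pmf (\<lambda>s. x $ s)"

text \<open>MWU update of both agents after sampling the pure profile (s1, s2);
  division by zero yields 0 (the convention 0/0 = 0).\<close>
definition mwu_update ::
  "real \<Rightarrow> ('a::finite \<Rightarrow> 'b::finite \<Rightarrow> real) \<Rightarrow> ('a, 'b) profile \<Rightarrow> 'a \<Rightarrow> 'b \<Rightarrow> ('a, 'b) profile" where
  "mwu_update \<eta> A X s1 s2 =
     ((\<chi> s. fst X $ s * exp (\<eta> * A s s2) /
            (\<Sum>t\<in>UNIV. fst X $ t * exp (\<eta> * A t s2))),
      (\<chi> s. snd X $ s * exp (\<eta> * (- A s1 s)) /
            (\<Sum>t\<in>UNIV. snd X $ t * exp (\<eta> * (- A s1 t)))))"

definition smwu_step ::
  "real \<Rightarrow> ('a::finite \<Rightarrow> 'b::finite \<Rightarrow> real) \<Rightarrow> ('a, 'b) profile \<Rightarrow> ('a, 'b) profile pmf" where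
  "smwu_step \<eta> A X =
     map_pmf (\<lambda>(s1, s2). mwu_update \<eta> A X s1 s2)
             (pair_pmf (mixed_pmf (fst X)) (mixed_pmf (snd X)))"

text \<open>Law of X^(t+1), started from X^1 = X0 (so smwu_law .. 0 is the law of X^1).\<close>
primrec smwu_law ::
  "real \<Rightarrow> ('a::finite \<Rightarrow> 'b::finite \<Rightarrow> real) \<Rightarrow> ('a, 'b) profile \<Rightarrow> nat \<Rightarrow> ('a, 'b) profile pmf" where
  "smwu_law \<eta> A X0 0 = return_pmf X0"
| "smwu_law \<eta> A X0 (Suc t) = bind_pmf (smwu_law \<eta> A X0 t) (smwu_step \<eta> A)"

text \<open>Time average of the laws of X^1, ..., X^T (T \<ge> 1) as a probability distribution.\<close>
definition smwu_avg ::
  "real \<Rightarrow> ('a::finite \<Rightarrow> 'b::finite \<Rightarrow> real) \<Rightarrow> ('a, 'b) profile \<Rightarrow> nat \<Rightarrow> ('a, 'b) profile pmf" where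
  "smwu_avg \<eta> A X0 T = bind_pmf (pmf_of_set {..<T}) (smwu_law \<eta> A X0)"

definition weakly_conv_to ::
  "(nat \<Rightarrow> 'c::topological_space measure) \<Rightarrow> 'c measure \<Rightarrow> bool" where
  "weakly_conv_to M L \<longleftrightarrow>
     (\<forall>f :: 'c \<Rightarrow> real. continuous_on UNIV f \<longrightarrow> bounded (range f) \<longrightarrow>
        (\<lambda>n. integral\<^sup>L (M n) f) \<longlonglongrightarrow> integral\<^sup>L L f)"

definition borel_prob :: "'c::topological_space measure \<Rightarrow> bool" where
  "borel_prob L \<longleftrightarrow> prob_space L \<and> sets L = sets borel"

end

theory Submission
  imports Defs
begin

text \<open>
  The profile space is compact, so the averaged laws have a weakly convergent subsequence, and every
  limit \<open>L\<close> is stationary. Faces of the profile space are preserved by the dynamics, so it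
  suffices that \<open>L\<close> gives no mass to the relative interior of a face \<open>S1 \<times> S2\<close> with more than one
  vertex. There, consider a potential \<open>\<Sum> c s ln (x s) + \<Sum> d s ln (y s)\<close>. Its increments are
  bounded, so they have mean zero under \<open>L\<close>; yet \<open>c\<close>, \<open>d\<close> can be chosen so that the conditional
  mean increment is positive everywhere on the face. By linear algebra there are three cases. Some
  \<open>c\<close> with \<open>\<Sum> c = 0\<close> has payoff \<open>c A\<close> equal to a positive constant on \<open>S2\<close>; then the
  normalisers cancel and the potential grows at a constant rate. Or the same holds for agent 2. Or
  both agents have (signed) equalising strategies \<open>p\<close>, \<open>q\<close>; then \<open>c = - p\<close>, \<open>d = - q\<close> leaves only the
  logarithms of the normalisers, whose mean is positive by strict Jensen, as the entries are
  distinct.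
\<close>

section \<open>Weak compactness on the cube\<close>

text \<open>Schoenberg's space-filling curve: at \<open>t = \<Sum> 2 a j / 3 ^ Suc j\<close> with digits \<open>a j \<in> {0, 1}\<close>, the
  2-periodic function \<open>schoenberg_step\<close> takes the value \<open>a m\<close> at \<open>3 ^ m * t\<close>, so interleaving the
  binary digits of \<open>n\<close> coordinates prescribes all of them at once.\<close>

definition ternary :: "(nat \<Rightarrow> real) \<Rightarrow> real" where
  "ternary a = (\<Sum>j. 2 * a j / 3 ^ Suc j)"

definition schoenberg_step :: "real \<Rightarrow> real" where
  "schoenberg_step u = max 0 (min 1 (1/2 - cos (pi * u)))"

definition schoenberg :: "nat \<Rightarrow> nat \<Rightarrow> real \<Rightarrow> real" where
  "schoenberg n i t = (\<Sum>k. (1/2) ^ Suc k * schoenberg_step (3 ^ (n * k + i) * t))"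

section \<open>Digits and values of Schoenberg's curve\<close>

lemma ternary_summable:
  assumes "\<And>j. a j \<in> {0, 1}"
  shows "summable (\<lambda>j. 2 * a j / 3 ^ Suc j :: real)"
proof (rule summable_comparison_test')
  show "summable (\<lambda>j. (1/3) ^ j :: real)" by (rule summable_geometric) simp
  show "norm (2 * a j / 3 ^ Suc j) \<le> (1/3) ^ j" if "j \<ge> 0" for j
    using assms[of j] by (auto simp: power_divide divide_simps)
qed

lemma ternary_bounds:
  assumes "\<And>j. a j \<in> {0, 1}"
  shows "0 \<le> ternary a" "ternary a \<le> 1"
proof -
  have nn: "0 \<le> a j" "a j \<le> 1" for j using assms[of j] by auto
  show "0 \<le> ternary a" unfolding ternary_def
    by (intro suminf_nonneg ternary_summable assms) (auto simp: nn)
  have "(\<lambda>j. (2/3) * (1/3) ^ j :: real) sums ((2/3) * (1 / (1 - 1/3)))"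
    by (intro sums_mult geometric_sums) simp
  then have s: "(\<lambda>j. (2/3) * (1/3) ^ j :: real) sums 1" by simp
  have "ternary a \<le> (\<Sum>j. (2/3) * (1/3) ^ j)" unfolding ternary_def
    using s nn by (intro suminf_le ternary_summable assms)
      (auto simp: power_divide divide_simps sums_iff)
  then show "ternary a \<le> 1" using s by (simp add: sums_iff)
qed

lemma ternary_shift:
  assumes "\<And>j. a j \<in> {0, 1}"
  shows "3 * ternary a = 2 * a 0 + ternary (\<lambda>j. a (Suc j))"
proof -
  have s: "summable (\<lambda>j. 2 * a (Suc j) / 3 ^ Suc j :: real)"
    using assms by (intro ternary_summable)
  have "ternary a = 2 * a 0 / 3 + (\<Sum>j. 2 * a (Suc j) / 3 ^ Suc (Suc j))"
    unfolding ternary_def using suminf_split_head[OF ternary_summable[of a]] assms by simp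
  also have "(\<Sum>j. 2 * a (Suc j) / 3 ^ Suc (Suc j)) = (\<Sum>j. 2 * a (Suc j) / 3 ^ Suc j / 3)"
    by simp
  also have "\<dots> = ternary (\<lambda>j. a (Suc j)) / 3"
    unfolding ternary_def by (rule suminf_divide[OF s])
  finally show ?thesis by simp
qed

text \<open>Each multiplication by 3 moves the leading digit in front of the ternary point, where it
  counts 0 or 2. The integer part therefore stays even, and the period 2 of
  \<open>schoenberg_step\<close> hides it.\<close>

lemma power3_ternary:
  assumes "\<And>j. a j \<in> {0, 1}"
  shows "\<exists>N::int. 3 ^ m * ternary a = 2 * of_int N + ternary (\<lambda>j. a (m + j))"
proof (induction m)
  case 0
  show ?case by (rule exI[of _ 0]) simp
next
  case (Suc m)
  then obtain N :: int where N: "3 ^ m * ternary a = 2 * of_int N + ternary (\<lambda>j. a (m + j))" by blast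
  obtain d :: int where d: "a m = of_int d"
    using assms[of m] by (metis insert_iff singletonD of_int_0 of_int_1)
  have "3 ^ Suc m * ternary a = 3 * (2 * of_int N) + 3 * ternary (\<lambda>j. a (m + j))"
    using N by (simp add: algebra_simps)
  also have "3 * ternary (\<lambda>j. a (m + j)) = 2 * a m + ternary (\<lambda>j. a (Suc m + j))"
    using ternary_shift[of "\<lambda>j. a (m + j)"] assms by simp
  finally show ?case using d by (intro exI[of _ "3 * N + d"]) simp
qed

text \<open>The first digit decides whether \<open>ternary b\<close> lies in [0, 1/3] or in
  [2/3, 1]. There 1/2 - cos (pi u) is at most 0, respectively at least 1, so clamping to [0, 1]
  returns the digit exactly.\<close>

lemma schoenberg_step_eq:
  assumes "\<And>j. b j \<in> {0, 1}"
  shows "schoenberg_step (2 * of_int N + ternary b) = b 0"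
proof -
  let ?r = "ternary (\<lambda>j. b (Suc j)) / 3"
  have r: "0 \<le> ?r" "?r \<le> 1/3" using ternary_bounds[of "\<lambda>j. b (Suc j)"] assms by auto
  have t: "ternary b = 2 * b 0 / 3 + ?r" using ternary_shift[of b] assms by simp
  have "cos (pi * (2 * of_int N + ternary b)) = cos (2 * pi * of_int N + pi * ternary b)"
    by (simp add: algebra_simps)
  also have "\<dots> = cos (pi * ternary b)"
    by (simp add: cos_add sin_int_2pin cos_int_2pin)
  finally have per: "cos (pi * (2 * of_int N + ternary b)) = cos (pi * ternary b)" .
  consider "b 0 = 0" | "b 0 = 1" using assms[of 0] by auto
  then show ?thesis
  proof cases
    case 1
    have "cos (pi / 3) \<le> cos (pi * ternary b)"
      using r t 1 by (intro cos_monotone_0_pi_le) auto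
    then show ?thesis using per 1 by (simp add: schoenberg_step_def cos_60)
  next
    case 2
    have "pi * (2/3) \<le> pi * ternary b" "pi * ternary b \<le> pi * 1"
      using r t 2 by (auto intro!: mult_left_mono)
    then have "cos (pi * ternary b) \<le> cos (pi * (2/3))"
      by (intro cos_monotone_0_pi_le) auto
    also have "cos (pi * (2/3)) = cos (pi - pi / 3)"
      by (rule arg_cong[of _ _ cos]) (simp add: field_simps)
    also have "\<dots> = - 1/2" unfolding cos_pi_minus cos_60 by simp
    finally show ?thesis using per 2 by (simp add: schoenberg_step_def)
  qed
qed

lemma schoenberg_continuous: "continuous_on UNIV (schoenberg n i)"
proof -
  have "uniform_limit UNIV (\<lambda>m t. \<Sum>k<m. (1/2) ^ Suc k * schoenberg_step (3 ^ (n * k + i) * t))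
          (schoenberg n i) sequentially"
    unfolding schoenberg_def
  proof (rule Weierstrass_m_test)
    show "summable (\<lambda>k. (1/2) ^ k :: real)" by (rule summable_geometric) simp
    show "norm ((1/2) ^ Suc k * schoenberg_step (3 ^ (n * k + i) * t)) \<le> (1/2) ^ k" for k t
      using mult_mono[of "(1/2) ^ Suc k" "(1/2) ^ k :: real"
          "schoenberg_step (3 ^ (n * k + i) * t)" 1]
      by (auto simp: schoenberg_step_def abs_mult)
  qed
  then show ?thesis
  proof (rule uniform_limit_theorem[rotated])
    show "\<forall>\<^sub>F m in sequentially. continuous_on UNIV
        (\<lambda>t. \<Sum>k<m. (1/2) ^ Suc k * schoenberg_step (3 ^ (n * k + i) * t))"
      unfolding schoenberg_step_def by (intro always_eventually allI continuous_intros)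
  qed simp
qed

text \<open>The sum telescopes: the first m digits give the floor of 2^m y divided by 2^m, which
  lies between y - 2^(-m) and y. The bound y < 1 makes the induction start at floor 0.\<close>

lemma binary_expansion:
  assumes "0 \<le> y" "y < 1"
  shows "(\<lambda>k. (1/2) ^ Suc k * of_int (\<lfloor>2 ^ Suc k * y\<rfloor> mod 2)) sums (y::real)"
proof -
  have step: "\<lfloor>2 * z\<rfloor> = 2 * \<lfloor>z\<rfloor> + \<lfloor>2 * z\<rfloor> mod 2" for z :: real
  proof -
    have "\<lfloor>2 * z\<rfloor> div 2 = \<lfloor>z\<rfloor>" by linarith
    then show ?thesis by presburger
  qed
  have part: "(\<Sum>k<m. (1/2) ^ Suc k * of_int (\<lfloor>2 ^ Suc k * y\<rfloor> mod 2)) = real_of_int \<lfloor>2 ^ m * y\<rfloor> / 2 ^ m" for m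
  proof (induction m)
    case 0
    have "\<lfloor>y\<rfloor> = 0" using assms by linarith
    then show ?case by simp
  next
    case (Suc m)
    have "(of_int \<lfloor>2 ^ Suc m * y\<rfloor> :: real)
        = 2 * of_int \<lfloor>2 ^ m * y\<rfloor> + of_int (\<lfloor>2 ^ Suc m * y\<rfloor> mod 2)"
      using arg_cong[OF step[of "2 ^ m * y"], of real_of_int] by (simp add: mult.assoc)
    with Suc show ?case by (simp add: power_divide field_simps)
  qed
  have "(\<lambda>m. of_int \<lfloor>2 ^ m * y\<rfloor> / 2 ^ m) \<longlonglongrightarrow> y"
  proof (rule tendsto_sandwich[where f = "\<lambda>m. y - (1/2) ^ m" and h = "\<lambda>m. y"])
    have "(2 ^ m * y - 1) / 2 ^ m \<le> of_int \<lfloor>2 ^ m * y\<rfloor> / 2 ^ m" for m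
      by (intro divide_right_mono) (linarith, simp)
    then show "\<forall>\<^sub>F m in sequentially. y - (1/2) ^ m \<le> of_int \<lfloor>2 ^ m * y\<rfloor> / 2 ^ m"
      by (auto simp: diff_divide_distrib power_divide)
    have "of_int \<lfloor>2 ^ m * y\<rfloor> / 2 ^ m \<le> (2 ^ m * y) / 2 ^ m" for m
      by (intro divide_right_mono) (linarith, simp)
    then show "\<forall>\<^sub>F m in sequentially. of_int \<lfloor>2 ^ m * y\<rfloor> / 2 ^ m \<le> y"
      by auto
    have "(\<lambda>m. y - (1/2) ^ m) \<longlonglongrightarrow> y - 0"
      by (intro tendsto_intros LIMSEQ_power_zero) simp
    then show "(\<lambda>m. y - (1/2) ^ m) \<longlonglongrightarrow> y" by simp
  qed simp
  then show ?thesis unfolding sums_def part .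
qed

text \<open>One digit sequence \<open>a\<close> interleaves all binary expansions: position n k + i
  holds digit k of \<open>y i\<close>, which is the position that the k-th summand of
  \<open>schoenberg n i\<close> reads.\<close>

lemma schoenberg_surj:
  assumes "\<And>i. i < n \<Longrightarrow> 0 \<le> y i \<and> y i < 1"
  shows "\<exists>t\<in>{0..1}. \<forall>i<n. schoenberg n i t = y i"
proof -
  define a where "a m = real_of_int (\<lfloor>2 ^ Suc (m div n) * y (m mod n)\<rfloor> mod 2)" for m
  have a01: "a m \<in> {0, 1}" for m
  proof -
    have "z mod 2 = 0 \<or> z mod 2 = 1" for z :: int by presburger
    then show ?thesis unfolding a_def by (metis insertCI of_int_0 of_int_1)
  qed
  show ?thesis
  proof (intro bexI[of _ "ternary a"] allI impI)
    show "ternary a \<in> {0..1}" using ternary_bounds[OF a01] by auto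
    fix i assume i: "i < n"
    have st: "schoenberg_step (3 ^ m * ternary a) = a m" for m
    proof -
      obtain N :: int where N: "3 ^ m * ternary a = 2 * of_int N + ternary (\<lambda>j. a (m + j))"
        using power3_ternary[of a m] a01 by blast
      show ?thesis unfolding N using schoenberg_step_eq[of "\<lambda>j. a (m + j)" N] a01 by simp
    qed
    have "a (n * k + i) = of_int (\<lfloor>2 ^ Suc k * y i\<rfloor> mod 2)" for k
      using i by (simp add: a_def)
    then show "schoenberg n i (ternary a) = y i"
      unfolding schoenberg_def st
      using binary_expansion[of "y i"] assms[OF i] by (simp add: sums_iff)
  qed
qed

section \<open>From the curve to weak compactness\<close>

lemma continuous_surj_cbox:
  obtains g :: "real \<Rightarrow> 'e::euclidean_space"
  where "continuous_on UNIV g" "cbox 0 One \<subseteq> g ` {0..1}"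
proof -
  obtain idx where idx: "bij_betw idx (Basis :: 'e set) {..<DIM('e)}"
    using ex_bij_betw_finite_nat[OF finite_Basis] by (metis lessThan_atLeast0)
  \<comment> \<open>Only coordinates below 1 are known to be attained. Aiming at half the point and
    doubling here covers the closed cube, including its sides at 1.\<close>
  define g :: "real \<Rightarrow> 'e" where
    "g t = (\<Sum>b\<in>Basis. (2 * schoenberg DIM('e) (idx b) t) *\<^sub>R b)" for t
  show ?thesis
  proof
    show "continuous_on UNIV g" unfolding g_def
      by (intro continuous_intros schoenberg_continuous)
    show "cbox 0 One \<subseteq> g ` {0..1}"
    proof
      fix x :: 'e assume x: "x \<in> cbox 0 One"
      define y where "y i = (x \<bullet> inv_into Basis idx i) / 2" for i
      have "0 \<le> y i \<and> y i < 1" if "i < DIM('e)" for i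
      proof -
        have "inv_into Basis idx i \<in> Basis"
          using that idx by (metis bij_betw_def inv_into_into lessThan_iff)
        then show ?thesis using x by (auto simp: y_def mem_box)
      qed
      then obtain t where t: "t \<in> {0..1}" "\<forall>i<DIM('e). schoenberg DIM('e) i t = y i"
        using schoenberg_surj by blast
      have "g t = (\<Sum>b\<in>Basis. (x \<bullet> b) *\<^sub>R b)" unfolding g_def
      proof (rule sum.cong)
        fix b :: 'e assume b: "b \<in> Basis"
        then have "idx b < DIM('e)" using idx by (auto simp: bij_betw_def)
        moreover have "inv_into Basis idx (idx b) = b"
          using idx b by (simp add: bij_betw_def)
        ultimately show "(2 * schoenberg DIM('e) (idx b) t) *\<^sub>R b = (x \<bullet> b) *\<^sub>R b"
          using t(2) y_def[of "idx b"] by simp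
      qed simp
      then show "x \<in> g ` {0..1}" using t by (auto simp: euclidean_representation)
    qed
  qed
qed

text \<open>Lift the measures along a continuous surjection from an interval onto the cube, apply
  Helly's selection theorem on the line, and push the limit forward again.\<close>
lemma weakly_conv_subseq_cube:
  fixes \<mu> :: "nat \<Rightarrow> 'e::euclidean_space pmf"
  assumes supp: "\<And>n. set_pmf (\<mu> n) \<subseteq> cbox 0 One"
  shows "\<exists>r L. strict_mono r \<and> borel_prob L \<and> weakly_conv_to (\<lambda>n. measure_pmf (\<mu> (r n))) L"
proof -
  obtain g :: "real \<Rightarrow> 'e" where g: "continuous_on UNIV g" "cbox 0 One \<subseteq> g ` {0..1}"
    by (rule continuous_surj_cbox)
  \<comment> \<open>Any right inverse will do: for the measure of a \<open>pmf\<close> every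
    function is measurable, so no measurable selection is required.\<close>
  define \<sigma> where "\<sigma> = inv_into {0..1} g"
  have \<sigma>: "\<sigma> x \<in> {0..1}" "g (\<sigma> x) = x" if "x \<in> cbox 0 One" for x
    using that g(2) inv_into_into[of x g "{0..1}"] f_inv_into_f[of x g "{0..1}"]
    unfolding \<sigma>_def by blast+
  define \<nu> where "\<nu> n = distr (measure_pmf (\<mu> n)) borel \<sigma>" for n
  have meas_g[measurable]: "g \<in> borel_measurable borel"
    using g(1) by (rule borel_measurable_continuous_onI)
  have prob: "prob_space (\<nu> n)" for n
    unfolding \<nu>_def by (rule prob_space.prob_space_distr) (auto intro: measure_pmf.prob_space_axioms)
  have real: "real_distribution (\<nu> n)" for n
    using prob by (auto simp: real_distribution_def real_distribution_axioms_def \<nu>_def)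
  have "measure (\<nu> n) {-1<..2} = 1" for n
  proof -
    have "AE x in measure_pmf (\<mu> n). \<sigma> x \<in> {-1<..2}"
      using supp[of n] \<sigma> by (force simp: AE_measure_pmf_iff)
    then have "AE x in \<nu> n. x \<in> {-1<..2}"
      unfolding \<nu>_def by (subst AE_distr_iff) auto
    then show ?thesis
      using prob_space.prob_eq_1[OF prob, of "{-1<..2}" n] by (simp add: \<nu>_def)
  qed
  then have "tight \<nu>"
    unfolding tight_def using real
    by (intro conjI allI impI exI[of _ "-1"] exI[of _ 2]) auto
  from tight_imp_convergent_subsubsequence[OF this, of id]
  obtain r M where r: "strict_mono r" and M: "real_distribution M" "weak_conv_m (\<nu> \<circ> r) M"
    by (auto simp: strict_mono_def)
  interpret M: real_distribution M by fact
  have "borel_prob (distr M borel g)"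
    unfolding borel_prob_def by (auto intro!: M.prob_space_distr)
  moreover have "weakly_conv_to (\<lambda>n. measure_pmf (\<mu> (r n))) (distr M borel g)"
    unfolding weakly_conv_to_def
  proof (intro allI impI)
    fix f :: "'e \<Rightarrow> real" assume f: "continuous_on UNIV f" "bounded (range f)"
    have [measurable]: "f \<in> borel_measurable borel"
      using f(1) by (rule borel_measurable_continuous_onI)
    obtain B where B: "\<And>x. norm (f x) \<le> B"
      using f(2) by (auto simp: bounded_iff)
    have cont: "continuous_on UNIV (\<lambda>t. f (g t))"
      by (rule continuous_on_compose2[OF f(1) g(1)]) simp
    have "(\<lambda>n. integral\<^sup>L (\<nu> (r n)) (\<lambda>t. f (g t))) \<longlonglongrightarrow> integral\<^sup>L M (\<lambda>t. f (g t))"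
      using weak_conv_imp_bdd_ae_continuous_conv[of "\<nu> \<circ> r" M "\<lambda>t. f (g t)" B] real M B cont
      by (auto simp: continuous_on_eq_continuous_at)
    moreover have "integral\<^sup>L (\<nu> (r n)) (\<lambda>t. f (g t)) = integral\<^sup>L (measure_pmf (\<mu> (r n))) f" for n
    proof -
      have "integral\<^sup>L (\<nu> (r n)) (\<lambda>t. f (g t)) = integral\<^sup>L (measure_pmf (\<mu> (r n))) (\<lambda>x. f (g (\<sigma> x)))"
        unfolding \<nu>_def by (rule integral_distr) auto
      also have "\<dots> = integral\<^sup>L (measure_pmf (\<mu> (r n))) f"
        using supp[of "r n"] \<sigma> by (intro integral_cong_AE) (auto simp: AE_measure_pmf_iff subset_eq)
      finally show ?thesis .
    qed
    moreover have "integral\<^sup>L M (\<lambda>t. f (g t)) = integral\<^sup>L (distr M borel g) f"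
      by (rule integral_distr[symmetric]) auto
    ultimately show "(\<lambda>n. integral\<^sup>L (measure_pmf (\<mu> (r n))) f) \<longlonglongrightarrow> integral\<^sup>L (distr M borel g) f"
      by simp
  qed
  ultimately show ?thesis using r by blast
qed

section \<open>The transition operator and stationarity of limits\<close>

lemma mixed_stratsD:
  assumes "x \<in> mixed_strats"
  shows "0 \<le> x $ s" "sum (($) x) UNIV = 1"
  using assms by (auto simp: mixed_strats_def)

lemma profilesD:
  assumes "X \<in> profiles"
  shows "fst X \<in> mixed_strats" "snd X \<in> mixed_strats"
    "0 \<le> fst X $ i" "0 \<le> snd X $ j" "sum (($) (fst X)) UNIV = 1" "sum (($) (snd X)) UNIV = 1"
  using assms by (auto simp: profiles_def mixed_strats_def)

text \<open>Applied to the normalisers of the update, this shows that division by zero never occurs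
  on \<open>profiles\<close>.\<close>

lemma mixed_strats_weighted_sum_pos:
  assumes "x \<in> mixed_strats" "\<And>s. 0 < w s"
  shows "0 < (\<Sum>s\<in>UNIV. x $ s * w s)"
proof -
  obtain s where "x $ s \<noteq> 0"
    using mixed_stratsD(2)[OF assms(1)] by (metis sum.neutral zero_neq_one)
  then have "0 < x $ s * w s"
    using mixed_stratsD(1)[OF assms(1), of s] assms(2)[of s] by simp
  then show ?thesis
    using mixed_stratsD(1)[OF assms(1)] assms(2)
    by (intro sum_pos2[where i = s]) (auto intro: mult_nonneg_nonneg less_imp_le)
qed

lemma compact_mixed_strats: "compact (mixed_strats :: (real^'a::finite) set)"
proof (subst compact_eq_bounded_closed, intro conjI)
  have "norm x \<le> 1" if "x \<in> mixed_strats" for x :: "real^'a"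
    using norm_le_l1_cart[of x] mixed_stratsD[OF that] by simp
  then show "bounded (mixed_strats :: (real^'a) set)" by (auto simp: bounded_iff)
  have "closed {x :: real^'a. 0 \<le> x $ s}" for s
    by (intro closed_Collect_le continuous_intros)
  moreover have "closed {x :: real^'a. (\<Sum>s\<in>UNIV. x $ s) = 1}"
    by (intro closed_Collect_eq continuous_intros)
  moreover have "mixed_strats = (\<Inter>s. {x :: real^'a. 0 \<le> x $ s}) \<inter> {x. (\<Sum>s\<in>UNIV. x $ s) = 1}"
    by (auto simp: mixed_strats_def)
  ultimately show "closed (mixed_strats :: (real^'a) set)"
    by (metis (no_types, lifting) closed_INT closed_Int)
qed

lemma compact_profiles: "compact profiles"
  unfolding profiles_def by (intro compact_Times compact_mixed_strats)

lemma mixed_strats_subset_cbox: "mixed_strats \<subseteq> cbox 0 One"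
proof
  fix x :: "real^'c::finite" assume x: "x \<in> mixed_strats"
  have "x $ s \<le> 1" for s
    using mixed_stratsD[OF x] member_le_sum[of s UNIV "($) x"] by simp
  moreover have "x \<bullet> i \<le> One \<bullet> i \<longleftrightarrow> x \<bullet> i \<le> 1" if "i \<in> Basis" for i
    using that by simp
  ultimately show "x \<in> cbox 0 One"
    using mixed_stratsD[OF x] unfolding mem_box by (auto simp: Basis_vec_def inner_axis)
qed

lemma profiles_subset_cbox: "profiles \<subseteq> cbox 0 One"
proof
  fix X :: "('a::finite, 'b::finite) profile" assume "X \<in> profiles"
  then have "fst X \<in> cbox 0 One" "snd X \<in> cbox 0 One"
    using mixed_strats_subset_cbox by (auto simp: profiles_def)
  then have "0 \<le> X \<bullet> i \<and> X \<bullet> i \<le> 1" if "i \<in> Basis" for i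
    using that unfolding mem_box by (cases X) (auto simp: Basis_prod_def)
  then show "X \<in> cbox 0 One"
    unfolding mem_box by simp
qed

lemma mwu_update_profiles:
  assumes "X \<in> profiles"
  shows "mwu_update \<eta> A X i j \<in> profiles"
proof -
  have "0 < (\<Sum>t\<in>UNIV. fst X $ t * exp (\<eta> * A t j))"
    "0 < (\<Sum>t\<in>UNIV. snd X $ t * exp (\<eta> * (- A i t)))"
    using profilesD[OF assms] by (auto intro!: mixed_strats_weighted_sum_pos)
  then show ?thesis
    using profilesD[OF assms]
    by (auto simp: mwu_update_def profiles_def mixed_strats_def sum_divide_distrib[symmetric])
qed

lemma continuous_on_mwu_update:
  "continuous_on profiles (\<lambda>X. mwu_update \<eta> A X i j)"
proof -
  have "(\<Sum>t\<in>UNIV. fst X $ t * exp (\<eta> * A t j)) \<noteq> 0"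
    "(\<Sum>t\<in>UNIV. snd X $ t * exp (\<eta> * (- A i t))) \<noteq> 0" if "X \<in> profiles" for X
    using mixed_strats_weighted_sum_pos[of "fst X" "\<lambda>t. exp (\<eta> * A t j)"]
      mixed_strats_weighted_sum_pos[of "snd X" "\<lambda>t. exp (\<eta> * (- A i t))"] profilesD[OF that] by auto
  then show ?thesis
    unfolding mwu_update_def by (intro continuous_on_Pair continuous_on_vec_lambda continuous_intros) auto
qed

lemma measurable_fst_nth [measurable]:
  "(\<lambda>X::('a::finite, 'b::finite) profile. fst X $ i) \<in> borel_measurable borel"
  by (intro borel_measurable_continuous_onI continuous_intros)

lemma measurable_snd_nth [measurable]:
  "(\<lambda>X::('a::finite, 'b::finite) profile. snd X $ i) \<in> borel_measurable borel"
  by (intro borel_measurable_continuous_onI continuous_intros)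

lemma measurable_mwu_update [measurable]:
  "(\<lambda>X. mwu_update \<eta> A X i j) \<in> borel_measurable borel"
proof -
  have lam: "(\<lambda>X. \<chi> s. f X s) \<in> borel_measurable borel"
    if "\<And>s. (\<lambda>X. f X s) \<in> borel_measurable borel"
    for f :: "('a, 'b) profile \<Rightarrow> 'c::finite \<Rightarrow> real"
    using that by (subst borel_measurable_euclidean_space) (auto simp: Basis_vec_def inner_axis)
  show ?thesis unfolding mwu_update_def
    by (intro borel_measurable_Pair lam) measurable
qed

text \<open>The Markov transition operator: on \<open>profiles\<close> it is the expectation of
  \<open>h\<close> after one step from \<open>X\<close>. The finite sum over raw coordinates also
  makes sense off \<open>profiles\<close>, so it is Borel measurable on the whole space whenever
  \<open>h\<close> is.\<close>

definition mwu_op ::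
  "real \<Rightarrow> ('a::finite \<Rightarrow> 'b::finite \<Rightarrow> real) \<Rightarrow> (('a, 'b) profile \<Rightarrow> real) \<Rightarrow> ('a, 'b) profile \<Rightarrow> real" where
  "mwu_op \<eta> A h X = (\<Sum>i\<in>UNIV. \<Sum>j\<in>UNIV. fst X $ i * snd X $ j * h (mwu_update \<eta> A X i j))"

lemma profile_weights_sum:
  assumes "X \<in> profiles"
  shows "(\<Sum>i\<in>UNIV. \<Sum>j\<in>UNIV. fst X $ i * snd X $ j * r) = r"
proof -
  have "(\<Sum>i\<in>UNIV. \<Sum>j\<in>UNIV. fst X $ i * snd X $ j * r)
      = (\<Sum>i\<in>UNIV. fst X $ i) * (\<Sum>j\<in>UNIV. snd X $ j) * r"
    by (simp add: sum_product) (simp add: sum_distrib_right)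
  then show ?thesis using profilesD[OF assms] by simp
qed

lemma mwu_op_diff:
  assumes "X \<in> profiles"
  shows "mwu_op \<eta> A h X - h X
    = (\<Sum>i\<in>UNIV. \<Sum>j\<in>UNIV. fst X $ i * snd X $ j * (h (mwu_update \<eta> A X i j) - h X))"
  using profile_weights_sum[OF assms, of "h X"]
  by (simp add: mwu_op_def right_diff_distrib sum_subtractf)

lemma profile_average_le:
  assumes "X \<in> profiles" "\<And>i j. \<bar>u i j\<bar> \<le> B"
  shows "\<bar>\<Sum>i\<in>UNIV. \<Sum>j\<in>UNIV. fst X $ i * snd X $ j * u i j\<bar> \<le> B"
proof -
  have "\<bar>\<Sum>i\<in>UNIV. \<Sum>j\<in>UNIV. fst X $ i * snd X $ j * u i j\<bar>
      \<le> (\<Sum>i\<in>UNIV. \<Sum>j\<in>UNIV. fst X $ i * snd X $ j * B)"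
    using profilesD[OF assms(1)] assms(2)
    by (intro order_trans[OF sum_abs] sum_mono) (auto simp: abs_mult intro!: mult_left_mono)
  then show ?thesis using profile_weights_sum[OF assms(1)] by simp
qed

lemma continuous_on_mwu_op:
  assumes "continuous_on profiles h"
  shows "continuous_on profiles (mwu_op \<eta> A h)"
  unfolding mwu_op_def
  by (intro continuous_intros continuous_on_compose2[OF assms continuous_on_mwu_update])
    (auto intro: mwu_update_profiles)

lemma measurable_mwu_op [measurable]:
  assumes [measurable]: "h \<in> borel_measurable borel"
  shows "mwu_op \<eta> A h \<in> borel_measurable borel"
  unfolding mwu_op_def by measurable

section \<open>Expectations under one step, the law at a given time, and the time average\<close>

lemma pmf_mixed_pmf:
  assumes "x \<in> mixed_strats"
  shows "pmf (mixed_pmf x) s = x $ s"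
  unfolding mixed_pmf_def using mixed_stratsD[OF assms]
  by (intro pmf_embed_pmf) (auto simp: nn_integral_count_space_finite)

lemma finite_set_smwu_step: "finite (set_pmf (smwu_step \<eta> A X))"
  unfolding smwu_step_def by simp

lemma set_smwu_step_subset:
  assumes "X \<in> profiles"
  shows "set_pmf (smwu_step \<eta> A X) \<subseteq> profiles"
  using mwu_update_profiles[OF assms] by (auto simp: smwu_step_def)

lemma expectation_smwu_step:
  assumes "X \<in> profiles"
  shows "measure_pmf.expectation (smwu_step \<eta> A X) h = mwu_op \<eta> A h X"
proof -
  have "measure_pmf.expectation (smwu_step \<eta> A X) h
      = (\<Sum>p\<in>UNIV. h (mwu_update \<eta> A X (fst p) (snd p))
          * pmf (pair_pmf (mixed_pmf (fst X)) (mixed_pmf (snd X))) p)"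
    unfolding smwu_step_def integral_map_pmf
    by (subst integral_measure_pmf_real[of UNIV]) (auto simp: case_prod_unfold)
  also have "\<dots> = (\<Sum>p\<in>UNIV \<times> UNIV. fst X $ fst p * snd X $ snd p * h (mwu_update \<eta> A X (fst p) (snd p)))"
  proof (rule sum.cong)
    fix p :: "'a \<times> 'b"
    show "h (mwu_update \<eta> A X (fst p) (snd p)) * pmf (pair_pmf (mixed_pmf (fst X)) (mixed_pmf (snd X))) p
        = fst X $ fst p * snd X $ snd p * h (mwu_update \<eta> A X (fst p) (snd p))"
      using profilesD[OF assms] by (cases p) (simp add: pmf_pair pmf_mixed_pmf)
  qed simp
  finally show ?thesis
    unfolding mwu_op_def sum.cartesian_product by (simp add: case_prod_unfold)
qed

lemma set_smwu_law:
  assumes "X0 \<in> profiles"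
  shows "finite (set_pmf (smwu_law \<eta> A X0 t)) \<and> set_pmf (smwu_law \<eta> A X0 t) \<subseteq> profiles"
proof (induction t)
  case (Suc t)
  then show ?case
    using finite_set_smwu_step set_smwu_step_subset by fastforce
qed (use assms in simp)

lemma expectation_smwu_law_Suc:
  assumes "X0 \<in> profiles"
  shows "measure_pmf.expectation (smwu_law \<eta> A X0 (Suc t)) h
    = measure_pmf.expectation (smwu_law \<eta> A X0 t) (mwu_op \<eta> A h)"
proof -
  let ?S = "set_pmf (smwu_law \<eta> A X0 t)"
  have fin: "finite ?S" and sub: "?S \<subseteq> profiles" using set_smwu_law[OF assms] by auto
  have "measure_pmf.expectation (smwu_law \<eta> A X0 (Suc t)) h
      = (\<Sum>X\<in>?S. pmf (smwu_law \<eta> A X0 t) X *\<^sub>R measure_pmf.expectation (smwu_step \<eta> A X) h)"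
    using fin finite_set_smwu_step unfolding smwu_law.simps
    by (intro pmf_expectation_bind) auto
  also have "\<dots> = (\<Sum>X\<in>?S. pmf (smwu_law \<eta> A X0 t) X *\<^sub>R mwu_op \<eta> A h X)"
    using sub by (intro sum.cong refl) (simp add: expectation_smwu_step subsetD)
  also have "\<dots> = measure_pmf.expectation (smwu_law \<eta> A X0 t) (mwu_op \<eta> A h)"
    using fin by (subst integral_measure_pmf[where A = ?S]) auto
  finally show ?thesis .
qed

lemma set_smwu_avg:
  assumes "X0 \<in> profiles" "0 < T"
  shows "set_pmf (smwu_avg \<eta> A X0 T) \<subseteq> profiles"
proof -
  have "{..<T} \<noteq> {}" using assms by auto
  then show ?thesis
    using set_smwu_law[OF assms(1)] by (auto simp: smwu_avg_def)
qed

lemma expectation_smwu_avg: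
  assumes "X0 \<in> profiles" "0 < T"
  shows "measure_pmf.expectation (smwu_avg \<eta> A X0 T) h
    = (\<Sum>t<T. measure_pmf.expectation (smwu_law \<eta> A X0 t) h) / T"
proof -
  have "{..<T} \<noteq> {}" using assms by auto
  then show ?thesis
    unfolding smwu_avg_def using set_smwu_law[OF assms(1)]
    by (subst pmf_expectation_bind_pmf_of_set) (auto simp: sum_distrib_left divide_inverse mult.commute)
qed

text \<open>Averaging over time telescopes the drift. Only the expectations of \<open>h\<close> at
  times T and 0 remain, each of modulus at most B.\<close>

lemma expectation_smwu_avg_drift:
  assumes X0: "X0 \<in> profiles" and B: "\<And>X. X \<in> profiles \<Longrightarrow> \<bar>h X\<bar> \<le> B" and T: "0 < T"
  shows "\<bar>measure_pmf.expectation (smwu_avg \<eta> A X0 T) (\<lambda>X. mwu_op \<eta> A h X - h X)\<bar> \<le> 2 * B / T"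
proof -
  let ?E = "\<lambda>t. measure_pmf.expectation (smwu_law \<eta> A X0 t) h"
  have int: "integrable (measure_pmf (smwu_law \<eta> A X0 t)) f" for t and f :: "_ \<Rightarrow> real"
    using set_smwu_law[OF X0] by (intro integrable_measure_pmf_finite) auto
  have E: "\<bar>?E t\<bar> \<le> B" for t
  proof -
    have ae: "AE X in measure_pmf (smwu_law \<eta> A X0 t). \<bar>h X\<bar> \<le> B"
      using set_smwu_law[OF X0, of \<eta> A t] B by (auto simp: AE_measure_pmf_iff)
    have "?E t \<le> B" using ae int by (intro measure_pmf.integral_le_const) auto
    moreover have "- B \<le> ?E t" using ae int by (intro measure_pmf.integral_ge_const) auto
    ultimately show ?thesis by simp
  qed
  have "measure_pmf.expectation (smwu_avg \<eta> A X0 T) (\<lambda>X. mwu_op \<eta> A h X - h X)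
      = (\<Sum>t<T. ?E (Suc t) - ?E t) / T"
    unfolding expectation_smwu_avg[OF X0 T] expectation_smwu_law_Suc[OF X0]
    by (simp add: int)
  also have "\<dots> = (?E T - ?E 0) / T"
    by (simp only: sum_lessThan_telescope[of ?E T])
  finally show ?thesis
    using E[of T] E[of 0] by (auto simp: abs_divide intro!: divide_right_mono)
qed

text \<open>The bounded continuous test function min 1 (infdist x S) has mean 0 under every
  \<open>\<mu> n\<close>, hence under \<open>L\<close>, and it is nonnegative. Its zero set is
  \<open>S\<close> because \<open>S\<close> is closed and nonempty; for an empty set
  \<open>infdist\<close> would be constantly 0.\<close>

lemma weak_limit_concentrated:
  fixes L :: "'e::euclidean_space measure" and \<mu> :: "nat \<Rightarrow> 'e pmf"
  assumes L: "borel_prob L" and conv: "weakly_conv_to (\<lambda>n. measure_pmf (\<mu> n)) L"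
    and S: "closed S" and supp: "\<And>n. set_pmf (\<mu> n) \<subseteq> S"
  shows "AE x in L. x \<in> S"
proof -
  interpret prob_space L using L by (simp add: borel_prob_def)
  have [measurable_cong]: "sets L = sets borel" using L by (simp add: borel_prob_def)
  have ne: "S \<noteq> {}" using supp[of 0] set_pmf_not_empty[of "\<mu> 0"] by auto
  define f where "f x = min 1 (infdist x S)" for x
  have f: "continuous_on UNIV f" "\<And>x. 0 \<le> f x" "\<And>x. f x \<le> 1"
    unfolding f_def by (auto intro!: continuous_intros simp: infdist_nonneg)
  then have [measurable]: "f \<in> borel_measurable borel"
    by (auto intro: borel_measurable_continuous_onI)
  have "(\<lambda>n. measure_pmf.expectation (\<mu> n) f) \<longlonglongrightarrow> integral\<^sup>L L f"
    using conv f unfolding weakly_conv_to_def by (auto simp: bounded_iff intro!: exI[of _ 1])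
  moreover have "measure_pmf.expectation (\<mu> n) f = 0" for n
    using supp[of n] by (intro integral_eq_zero_AE) (auto simp: AE_measure_pmf_iff f_def)
  ultimately have "integral\<^sup>L L f = 0" by (simp add: LIMSEQ_const_iff)
  moreover have "integrable L f"
    using f by (intro integrable_const_bound[of _ 1]) auto
  ultimately have "AE x in L. f x = 0"
    using f by (subst (asm) integral_nonneg_eq_0_iff_AE) auto
  then show ?thesis
    by eventually_elim (use ne S in \<open>auto simp: f_def min_def in_closed_iff_infdist_zero split: if_splits\<close>)
qed

text \<open>Weak convergence tests functions continuous on the whole space, but the update is shown
  continuous only on \<open>profiles\<close>. Tietze's theorem replaces \<open>f\<close> by a
  bounded continuous extension from \<open>S\<close>, and all the measures live on
  \<open>S\<close>.\<close>

lemma weak_limit_integral_closed: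
  fixes L :: "'e::euclidean_space measure" and \<mu> :: "nat \<Rightarrow> 'e pmf" and f :: "'e \<Rightarrow> real"
  assumes L: "borel_prob L" and conv: "weakly_conv_to (\<lambda>n. measure_pmf (\<mu> n)) L"
    and S: "compact S" and supp: "\<And>n. set_pmf (\<mu> n) \<subseteq> S"
    and f: "continuous_on S f" and [measurable]: "f \<in> borel_measurable borel"
  shows "(\<lambda>n. measure_pmf.expectation (\<mu> n) f) \<longlonglongrightarrow> integral\<^sup>L L f"
proof -
  have [measurable_cong]: "sets L = sets borel" using L by (simp add: borel_prob_def)
  have cl: "closed S" using S by (rule compact_imp_closed)
  obtain B where B: "0 \<le> B" "\<And>x. x \<in> S \<Longrightarrow> norm (f x) \<le> B"
    using compact_imp_bounded[OF compact_continuous_image[OF f S]]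
    by (metis bounded_pos image_eqI less_imp_le)
  obtain g where g: "continuous_on UNIV g" "\<And>x. x \<in> S \<Longrightarrow> g x = f x" "\<And>x. norm (g x) \<le> B"
    using Tietze[OF f _ B, of UNIV] cl by auto
  have [measurable]: "g \<in> borel_measurable borel"
    using g(1) by (rule borel_measurable_continuous_onI)
  have "(\<lambda>n. measure_pmf.expectation (\<mu> n) g) \<longlonglongrightarrow> integral\<^sup>L L g"
    using conv g unfolding weakly_conv_to_def by (auto simp: bounded_iff)
  moreover have "measure_pmf.expectation (\<mu> n) g = measure_pmf.expectation (\<mu> n) f" for n
    using supp[of n] g by (intro integral_cong_AE) (auto simp: AE_measure_pmf_iff)
  moreover have "integral\<^sup>L L g = integral\<^sup>L L f"
    using weak_limit_concentrated[OF L conv cl supp] g by (intro integral_cong_AE) auto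
  ultimately show ?thesis by simp
qed

text \<open>Stationarity in weak form: it is tested on continuous functions only, which is what a
  weak limit delivers directly.\<close>

definition mwu_invariant ::
  "real \<Rightarrow> ('a::finite \<Rightarrow> 'b::finite \<Rightarrow> real) \<Rightarrow> ('a, 'b) profile measure \<Rightarrow> bool" where
  "mwu_invariant \<eta> A L \<longleftrightarrow> borel_prob L \<and> (AE X in L. X \<in> profiles) \<and>
     (\<forall>h. continuous_on UNIV h \<longrightarrow> integral\<^sup>L L (\<lambda>X. mwu_op \<eta> A h X - h X) = 0)"

text \<open>The Krylov-Bogoliubov argument. The drift of a continuous \<open>h\<close> is continuous
  on \<open>profiles\<close>, so its means converge to the mean under \<open>L\<close>; by
  telescoping they are also of order 1/T.\<close>

lemma mwu_invariant_limit:
  assumes X0: "X0 \<in> profiles" and r: "strict_mono r" and L: "borel_prob L"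
    and conv: "weakly_conv_to (\<lambda>n. measure_pmf (smwu_avg \<eta> A X0 (Suc (r n)))) L"
  shows "mwu_invariant \<eta> A L"
proof -
  have supp: "set_pmf (smwu_avg \<eta> A X0 (Suc (r n))) \<subseteq> profiles" for n
    using set_smwu_avg[OF X0] by simp
  have "integral\<^sup>L L (\<lambda>X. mwu_op \<eta> A h X - h X) = 0" if h: "continuous_on UNIV h" for h
  proof -
    let ?D = "\<lambda>X. mwu_op \<eta> A h X - h X"
    have hp: "continuous_on profiles h" using h by (rule continuous_on_subset) simp
    have [measurable]: "h \<in> borel_measurable borel" using h by (rule borel_measurable_continuous_onI)
    obtain B where B: "\<And>X. X \<in> profiles \<Longrightarrow> \<bar>h X\<bar> \<le> B"
      using compact_imp_bounded[OF compact_continuous_image[OF hp compact_profiles]]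
      by (auto simp: bounded_iff)
    have "(\<lambda>n. measure_pmf.expectation (smwu_avg \<eta> A X0 (Suc (r n))) ?D) \<longlonglongrightarrow> integral\<^sup>L L ?D"
      by (rule weak_limit_integral_closed[OF L conv compact_profiles supp])
        (auto intro!: continuous_intros continuous_on_mwu_op hp)
    moreover have "(\<lambda>n. measure_pmf.expectation (smwu_avg \<eta> A X0 (Suc (r n))) ?D) \<longlonglongrightarrow> 0"
    proof (rule Lim_null_comparison)
      show "\<forall>\<^sub>F n in sequentially.
          norm (measure_pmf.expectation (smwu_avg \<eta> A X0 (Suc (r n))) ?D) \<le> 2 * B / Suc (r n)"
        unfolding real_norm_def by (intro always_eventually allI expectation_smwu_avg_drift X0 B) auto
      have "(\<lambda>n. 2 * B * inverse (real (Suc n))) \<longlonglongrightarrow> 2 * B * 0"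
        by (intro tendsto_intros LIMSEQ_inverse_real_of_nat)
      then have "((\<lambda>n. 2 * B / Suc n) \<circ> r) \<longlonglongrightarrow> 0"
        by (intro LIMSEQ_subseq_LIMSEQ[OF _ r]) (simp add: divide_inverse)
      then show "(\<lambda>n. 2 * B / Suc (r n)) \<longlonglongrightarrow> 0" by (simp add: o_def)
    qed
    ultimately show ?thesis by (rule LIMSEQ_unique)
  qed
  moreover have "AE X in L. X \<in> profiles"
    by (rule weak_limit_concentrated[OF L conv compact_imp_closed[OF compact_profiles] supp])
  ultimately show ?thesis using L by (simp add: mwu_invariant_def)
qed

text \<open>Carries stationarity from continuous functions to their bounded pointwise limits.
  Convergence is required at every profile, not only almost everywhere, since \<open>mwu_op\<close>
  evaluates the functions at updated profiles.\<close>

lemma drift_integral_bounded_limit: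
  assumes L: "borel_prob L" and prof: "AE X in L. X \<in> profiles"
    and meas: "\<And>k. h k \<in> borel_measurable borel" "g \<in> borel_measurable borel"
    and bdd: "\<And>k X. X \<in> profiles \<Longrightarrow> \<bar>h k X\<bar> \<le> B"
    and lim: "\<And>X. X \<in> profiles \<Longrightarrow> (\<lambda>k. h k X) \<longlonglongrightarrow> g X"
    and inv: "\<And>k. integral\<^sup>L L (\<lambda>X. mwu_op \<eta> A (h k) X - h k X) = 0"
  shows "integral\<^sup>L L (\<lambda>X. mwu_op \<eta> A g X - g X) = 0"
proof -
  interpret prob_space L using L by (simp add: borel_prob_def)
  have [measurable_cong]: "sets L = sets borel" using L by (simp add: borel_prob_def)
  note [measurable] = meas
  have "(\<lambda>k. integral\<^sup>L L (\<lambda>X. mwu_op \<eta> A (h k) X - h k X))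
      \<longlonglongrightarrow> integral\<^sup>L L (\<lambda>X. mwu_op \<eta> A g X - g X)"
  proof (rule integral_dominated_convergence[where w = "\<lambda>_. 2 * B"])
    show "AE X in L. (\<lambda>k. mwu_op \<eta> A (h k) X - h k X) \<longlonglongrightarrow> mwu_op \<eta> A g X - g X"
      using prof
    proof eventually_elim
      fix X :: "('a, 'b) profile" assume X: "X \<in> profiles"
      show "(\<lambda>k. mwu_op \<eta> A (h k) X - h k X) \<longlonglongrightarrow> mwu_op \<eta> A g X - g X"
        unfolding mwu_op_def using X mwu_update_profiles[OF X]
        by (intro tendsto_intros lim)
    qed
    show "AE X in L. norm (mwu_op \<eta> A (h k) X - h k X) \<le> 2 * B" for k
      using prof
    proof eventually_elim
      fix X :: "('a, 'b) profile" assume X: "X \<in> profiles"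
      have "\<bar>mwu_op \<eta> A (h k) X\<bar> \<le> B"
        unfolding mwu_op_def by (intro profile_average_le[OF X] bdd mwu_update_profiles[OF X])
      then show "norm (mwu_op \<eta> A (h k) X - h k X) \<le> 2 * B"
        using bdd[OF X, of k] by simp
    qed
  qed auto
  then show ?thesis using inv by (simp add: LIMSEQ_const_iff)
qed

section \<open>Logarithmic potentials on faces\<close>

text \<open>The supports are prescribed exactly, so within \<open>profiles\<close> this is the
  relative interior of a face. These sets partition \<open>profiles\<close>.\<close>

definition face :: "'a::finite set \<Rightarrow> 'b::finite set \<Rightarrow> ('a, 'b) profile set" where
  "face S1 S2 = {X. (\<forall>i. fst X $ i \<noteq> 0 \<longleftrightarrow> i \<in> S1) \<and> (\<forall>j. snd X $ j \<noteq> 0 \<longleftrightarrow> j \<in> S2)}"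

abbreviation (input) normaliser1 ::
  "real \<Rightarrow> ('a::finite \<Rightarrow> 'b::finite \<Rightarrow> real) \<Rightarrow> ('a, 'b) profile \<Rightarrow> 'b \<Rightarrow> real" where
  "normaliser1 \<eta> A X j \<equiv> \<Sum>t\<in>UNIV. fst X $ t * exp (\<eta> * A t j)"

abbreviation (input) normaliser2 ::
  "real \<Rightarrow> ('a::finite \<Rightarrow> 'b::finite \<Rightarrow> real) \<Rightarrow> ('a, 'b) profile \<Rightarrow> 'a \<Rightarrow> real" where
  "normaliser2 \<eta> A X i \<equiv> \<Sum>t\<in>UNIV. snd X $ t * exp (\<eta> * (- A i t))"

definition log_potential ::
  "('a::finite \<Rightarrow> real) \<Rightarrow> ('b::finite \<Rightarrow> real) \<Rightarrow> ('a, 'b) profile \<Rightarrow> real" where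
  "log_potential c d X = (\<Sum>s\<in>UNIV. c s * ln (fst X $ s)) + (\<Sum>s\<in>UNIV. d s * ln (snd X $ s))"

text \<open>Logarithms turn the multiplicative update into addition. This is the resulting change of
  \<open>log_potential\<close> when (i, j) is sampled, and \<open>log_drift\<close> below is its
  conditional mean given \<open>X\<close>.\<close>

definition log_increment ::
  "real \<Rightarrow> ('a::finite \<Rightarrow> 'b::finite \<Rightarrow> real) \<Rightarrow> ('a \<Rightarrow> real) \<Rightarrow> ('b \<Rightarrow> real) \<Rightarrow> ('a, 'b) profile \<Rightarrow> 'a \<Rightarrow> 'b \<Rightarrow> real" where
  "log_increment \<eta> A c d X i j =
     (\<Sum>s\<in>UNIV. c s * (\<eta> * A s j - ln (normaliser1 \<eta> A X j))) +
     (\<Sum>s\<in>UNIV. d s * (\<eta> * (- A i s) - ln (normaliser2 \<eta> A X i)))"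

definition log_drift ::
  "real \<Rightarrow> ('a::finite \<Rightarrow> 'b::finite \<Rightarrow> real) \<Rightarrow> ('a \<Rightarrow> real) \<Rightarrow> ('b \<Rightarrow> real) \<Rightarrow> ('a, 'b) profile \<Rightarrow> real" where
  "log_drift \<eta> A c d X =
     (\<Sum>i\<in>UNIV. \<Sum>j\<in>UNIV. fst X $ i * snd X $ j * log_increment \<eta> A c d X i j)"

lemma norm_pos:
  assumes "X \<in> profiles"
  shows "0 < normaliser1 \<eta> A X j" "0 < normaliser2 \<eta> A X i"
  using profilesD[OF assms] by (auto intro!: mixed_strats_weighted_sum_pos)

text \<open>The update multiplies every coordinate by a positive factor, so supports neither shrink
  nor grow. The equivalence lets the indicator of a face pass through \<open>mwu_op\<close>.\<close>

lemma mwu_update_face: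
  assumes "X \<in> profiles"
  shows "mwu_update \<eta> A X i j \<in> face S1 S2 \<longleftrightarrow> X \<in> face S1 S2"
  using norm_pos[OF assms, of \<eta> A] by (simp add: mwu_update_def face_def less_imp_neq[symmetric])

text \<open>Coordinates inside the face are positive, so their logarithms split. Outside it the
  coefficients vanish, which neutralises whatever value \<open>ln\<close> takes at 0.\<close>

lemma log_potential_update:
  assumes X: "X \<in> profiles" "X \<in> face S1 S2"
    and c: "\<And>i. i \<notin> S1 \<Longrightarrow> c i = 0" and d: "\<And>j. j \<notin> S2 \<Longrightarrow> d j = 0"
  shows "log_potential c d (mwu_update \<eta> A X i j) = log_potential c d X + log_increment \<eta> A c d X i j"
proof -
  note Z = norm_pos[OF X(1), of \<eta> A]
  have ln: "ln (x * exp u / Z) = ln x + (u - ln Z)" if "0 < x" "0 < Z" for x u Z :: real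
    using that by (simp add: ln_div ln_mult)
  have 1: "c s * ln (fst (mwu_update \<eta> A X i j) $ s)
      = c s * ln (fst X $ s) + c s * (\<eta> * A s j - ln (normaliser1 \<eta> A X j))" for s
  proof (cases "s \<in> S1")
    case True
    then have "0 < fst X $ s" using X profilesD(3)[OF X(1), of s] by (simp add: face_def less_le)
    from ln[OF this Z(1)] show ?thesis by (simp add: mwu_update_def distrib_left)
  qed (simp add: c)
  have 2: "d s * ln (snd (mwu_update \<eta> A X i j) $ s)
      = d s * ln (snd X $ s) + d s * (\<eta> * (- A i s) - ln (normaliser2 \<eta> A X i))" for s
  proof (cases "s \<in> S2")
    case True
    then have "0 < snd X $ s" using X profilesD(4)[OF X(1), of s] by (simp add: face_def less_le)
    from ln[OF this Z(2)] show ?thesis by (simp add: mwu_update_def distrib_left)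
  qed (simp add: d)
  show ?thesis unfolding log_potential_def log_increment_def 1 2 by (simp add: sum.distrib)
qed

text \<open>Positive normalisers make each increment continuous on the compact set
  \<open>profiles\<close>, even where a coordinate is 0; there are finitely many pairs (i,
  j).\<close>

lemma log_increment_bounded:
  obtains C where "\<And>X i j. X \<in> profiles \<Longrightarrow> \<bar>log_increment \<eta> A c d X i j\<bar> \<le> C"
proof -
  have "\<exists>C. \<forall>X\<in>profiles. \<bar>log_increment \<eta> A c d X i j\<bar> \<le> C" for i j
  proof -
    have "continuous_on profiles (\<lambda>X. log_increment \<eta> A c d X i j)"
      unfolding log_increment_def
      using norm_pos[of _ \<eta> A] by (intro continuous_intros) (auto simp: less_imp_neq[symmetric])
    from compact_imp_bounded[OF compact_continuous_image[OF this compact_profiles]]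
    show ?thesis by (auto simp: bounded_iff)
  qed
  then obtain C where C: "\<And>i j X. X \<in> profiles \<Longrightarrow> \<bar>log_increment \<eta> A c d X i j\<bar> \<le> C i j"
    by metis
  show ?thesis
  proof
    fix X :: "('a, 'b) profile" and i :: 'a and j :: 'b
    assume "X \<in> profiles"
    then have "\<bar>log_increment \<eta> A c d X i j\<bar> \<le> C i j" by (rule C)
    also have "\<dots> \<le> Max (range (\<lambda>p. C (fst p) (snd p)))"
      by (intro Max_ge) (auto intro!: image_eqI[of _ _ "(i, j)"])
    finally show "\<bar>log_increment \<eta> A c d X i j\<bar> \<le> Max (range (\<lambda>p. C (fst p) (snd p)))" .
  qed
qed

section \<open>Truncation and continuous approximation of face indicators\<close>

definition truncate :: "real \<Rightarrow> real \<Rightarrow> real" where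
  "truncate N z = max (- N) (min N z)"

lemma truncate_bound: "0 \<le> N \<Longrightarrow> \<bar>truncate N z\<bar> \<le> N"
  by (auto simp: truncate_def)

lemma truncate_Lipschitz: "\<bar>truncate N a - truncate N b\<bar> \<le> \<bar>a - b\<bar>"
  by (auto simp: truncate_def max_def min_def)

lemma tendsto_truncate: "(\<lambda>n. truncate (real n) z) \<longlonglongrightarrow> z"
proof (rule tendsto_eventually)
  show "\<forall>\<^sub>F n in sequentially. truncate (real n) z = z"
    using eventually_ge_at_top[of "nat \<lceil>\<bar>z\<bar>\<rceil>"]
    by eventually_elim (auto simp: truncate_def max_def min_def; linarith)
qed

lemma continuous_on_truncate [continuous_intros]:
  "continuous_on S f \<Longrightarrow> continuous_on S (\<lambda>x. truncate N (f x))"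
  unfolding truncate_def by (intro continuous_intros)

definition soft_nonzero :: "nat \<Rightarrow> real \<Rightarrow> real" where
  "soft_nonzero k z = min 1 (real (Suc k) * \<bar>z\<bar>)"

lemma tendsto_soft_nonzero: "(\<lambda>k. soft_nonzero k z) \<longlonglongrightarrow> of_bool (z \<noteq> 0)"
proof (cases "z = 0")
  case False
  show ?thesis
  proof (rule tendsto_eventually)
    show "\<forall>\<^sub>F k in sequentially. soft_nonzero k z = of_bool (z \<noteq> 0)"
      using eventually_ge_at_top[of "nat \<lceil>1 / \<bar>z\<bar>\<rceil>"]
    proof eventually_elim
      fix k assume "nat \<lceil>1 / \<bar>z\<bar>\<rceil> \<le> k"
      then have "1 / \<bar>z\<bar> \<le> real (Suc k)" by linarith
      then show "soft_nonzero k z = of_bool (z \<noteq> 0)"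
        using False by (simp add: soft_nonzero_def field_simps)
    qed
  qed
qed (simp add: soft_nonzero_def)

text \<open>A face is in general neither open nor closed, yet its indicator is a pointwise limit of
  these continuous functions with values in [0, 1], built with one factor per coordinate.\<close>

definition soft_face :: "nat \<Rightarrow> 'a::finite set \<Rightarrow> 'b::finite set \<Rightarrow> ('a, 'b) profile \<Rightarrow> real" where
  "soft_face k S1 S2 X =
     (\<Prod>i\<in>UNIV. if i \<in> S1 then soft_nonzero k (fst X $ i) else 1 - soft_nonzero k (fst X $ i)) *
     (\<Prod>j\<in>UNIV. if j \<in> S2 then soft_nonzero k (snd X $ j) else 1 - soft_nonzero k (snd X $ j))"

lemma continuous_on_if_const:
  "(b \<Longrightarrow> continuous_on S f) \<Longrightarrow> (\<not> b \<Longrightarrow> continuous_on S g) \<Longrightarrow> continuous_on S (\<lambda>x. if b then f x else g x)"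
  by (cases b) simp_all

lemma continuous_on_soft_face: "continuous_on S (soft_face k S1 S2)"
  unfolding soft_face_def soft_nonzero_def
  by (intro continuous_intros continuous_on_if_const)

lemma soft_face_bounds: "0 \<le> soft_face k S1 S2 X" "soft_face k S1 S2 X \<le> 1"
proof -
  have s: "0 \<le> soft_nonzero k z" "soft_nonzero k z \<le> 1" for z by (auto simp: soft_nonzero_def)
  show "0 \<le> soft_face k S1 S2 X" unfolding soft_face_def
    using s by (intro mult_nonneg_nonneg prod_nonneg) auto
  show "soft_face k S1 S2 X \<le> 1" unfolding soft_face_def
    using s by (intro mult_le_one prod_nonneg prod_le_1) auto
qed

lemma tendsto_soft_face: "(\<lambda>k. soft_face k S1 S2 X) \<longlonglongrightarrow> indicator (face S1 S2) X"
proof -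
  have t: "(\<lambda>k. if b then soft_nonzero k z else 1 - soft_nonzero k z) \<longlonglongrightarrow> (of_bool (z \<noteq> 0 \<longleftrightarrow> b) :: real)" for b and z :: real
  proof (cases b)
    case False
    have "(\<lambda>k. 1 - soft_nonzero k z) \<longlonglongrightarrow> 1 - of_bool (z \<noteq> 0)"
      by (intro tendsto_diff tendsto_const tendsto_soft_nonzero)
    then show ?thesis using False by (simp add: of_bool_def split: if_splits)
  qed (use tendsto_soft_nonzero[of z] in simp)
  have "(\<lambda>k. soft_face k S1 S2 X) \<longlonglongrightarrow>
      (\<Prod>i\<in>UNIV. of_bool (fst X $ i \<noteq> 0 \<longleftrightarrow> i \<in> S1)) * (\<Prod>j\<in>UNIV. of_bool (snd X $ j \<noteq> 0 \<longleftrightarrow> j \<in> S2))"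
    unfolding soft_face_def by (intro tendsto_mult tendsto_prod t)
  moreover have "(\<Prod>i\<in>UNIV. of_bool (fst X $ i \<noteq> 0 \<longleftrightarrow> i \<in> S1)) *
      (\<Prod>j\<in>UNIV. of_bool (snd X $ j \<noteq> 0 \<longleftrightarrow> j \<in> S2)) = (indicator (face S1 S2) X :: real)"
    by (auto simp: face_def indicator_def)
  ultimately show ?thesis by simp
qed

lemma tendsto_ln_cutoff:
  assumes "0 < z"
  shows "(\<lambda>k. ln (max z (1 / real (Suc k)))) \<longlonglongrightarrow> ln z"
proof (rule tendsto_eventually)
  show "\<forall>\<^sub>F k in sequentially. ln (max z (1 / real (Suc k))) = ln z"
    using order_tendstoD(2)[OF LIMSEQ_inverse_real_of_nat assms]
    by eventually_elim (simp add: max_def divide_inverse)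
qed

section \<open>Vanishing mean drift under a stationary law\<close>

lemma face_measurable [measurable]: "face S1 S2 \<in> sets borel"
  unfolding face_def by measurable

lemma log_potential_measurable [measurable]: "log_potential c d \<in> borel_measurable borel"
  unfolding log_potential_def by measurable

lemma truncate_measurable [measurable]: "truncate N \<in> borel_measurable borel"
  unfolding truncate_def by measurable

lemma truncated_log_drift_integral:
  assumes inv: "mwu_invariant \<eta> A L" and N: "0 \<le> N"
    and c: "\<And>i. i \<notin> S1 \<Longrightarrow> c i = 0" and d: "\<And>j. j \<notin> S2 \<Longrightarrow> d j = 0"
  defines "g \<equiv> \<lambda>X. truncate N (log_potential c d X) * indicator (face S1 S2) X"
  shows "integral\<^sup>L L (\<lambda>X. mwu_op \<eta> A g X - g X) = 0"
proof -
  \<comment> \<open>Raising each coordinate to at least 1/(k+1) keeps \<open>ln\<close> away from 0,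
    so \<open>f k\<close> is continuous on the whole space; on the face the cutoff is eventually
    inactive in every coordinate with nonzero coefficient.\<close>
  define f where "f k X = (\<Sum>s\<in>UNIV. c s * ln (max (fst X $ s) (1 / real (Suc k))))
      + (\<Sum>s\<in>UNIV. d s * ln (max (snd X $ s) (1 / real (Suc k))))" for k and X :: "('a, 'b) profile"
  define h where "h k X = truncate N (f k X) * soft_face k S1 S2 X" for k X
  have pos: "0 < max x (1 / real (Suc k))" for x k by (rule less_max_iff_disj[THEN iffD2]) simp
  then have cont: "continuous_on UNIV (h k)" for k
    unfolding h_def f_def
    by (intro continuous_intros continuous_on_soft_face) (metis less_irrefl)+
  have bdd: "\<bar>h k X\<bar> \<le> N" for k X
    using mult_mono[OF truncate_bound[OF N] soft_face_bounds(2) N soft_face_bounds(1), of "f k X" k S1 S2 X]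
      soft_face_bounds(1)[of k S1 S2 X]
    by (simp add: h_def abs_mult)
  have lim: "(\<lambda>k. h k X) \<longlonglongrightarrow> g X" if X: "X \<in> profiles" for X
  proof (cases "X \<in> face S1 S2")
    case True
    have "(\<lambda>k. c s * ln (max (fst X $ s) (1 / real (Suc k)))) \<longlonglongrightarrow> c s * ln (fst X $ s)" for s
    proof (cases "s \<in> S1")
      case s: True
      then have "0 < fst X $ s" using True profilesD(3)[OF X, of s] by (simp add: face_def less_le)
      then show ?thesis by (intro tendsto_intros tendsto_ln_cutoff)
    qed (simp add: c)
    moreover have "(\<lambda>k. d s * ln (max (snd X $ s) (1 / real (Suc k)))) \<longlonglongrightarrow> d s * ln (snd X $ s)" for s
    proof (cases "s \<in> S2")
      case s: True
      then have "0 < snd X $ s" using True profilesD(4)[OF X, of s] by (simp add: face_def less_le)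
      then show ?thesis by (intro tendsto_intros tendsto_ln_cutoff)
    qed (simp add: d)
    ultimately have "(\<lambda>k. f k X) \<longlonglongrightarrow> log_potential c d X"
      unfolding f_def log_potential_def by (intro tendsto_add tendsto_sum)
    then show ?thesis
      unfolding h_def g_def truncate_def
      by (intro tendsto_mult tendsto_max tendsto_min tendsto_const tendsto_soft_face)
  next
    case False
    \<comment> \<open>Off the face \<open>f k X\<close> may diverge, but truncation bounds it by N
      and the factor \<open>soft_face\<close> tends to 0.\<close>
    have "(\<lambda>k. N * soft_face k S1 S2 X) \<longlonglongrightarrow> N * 0"
      using tendsto_soft_face[of S1 S2 X] False by (intro tendsto_intros) simp
    then have "(\<lambda>k. N * soft_face k S1 S2 X) \<longlonglongrightarrow> 0" by simp
    then have "(\<lambda>k. h k X) \<longlonglongrightarrow> 0"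
      by (rule Lim_null_comparison[rotated])
        (auto simp: h_def abs_mult soft_face_bounds intro!: always_eventually mult_right_mono truncate_bound N)
    then show ?thesis using False by (simp add: g_def)
  qed
  show ?thesis
  proof (rule drift_integral_bounded_limit[where h = h])
    show "borel_prob L" "AE X in L. X \<in> profiles" using inv by (auto simp: mwu_invariant_def)
    show "h k \<in> borel_measurable borel" for k using cont by (rule borel_measurable_continuous_onI)
    show "g \<in> borel_measurable borel" unfolding g_def by measurable
    show "integral\<^sup>L L (\<lambda>X. mwu_op \<eta> A (h k) X - h k X) = 0" for k
      using inv cont by (simp add: mwu_invariant_def)
  qed (use bdd lim in auto)
qed

text \<open>The potential itself need not be integrable; its increments are bounded, so truncation
  and dominated convergence still give a vanishing mean increment.\<close>
lemma log_drift_integral: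
  assumes inv: "mwu_invariant \<eta> A L"
    and c: "\<And>i. i \<notin> S1 \<Longrightarrow> c i = 0" and d: "\<And>j. j \<notin> S2 \<Longrightarrow> d j = 0"
  shows "integrable L (\<lambda>X. indicator (face S1 S2) X * log_drift \<eta> A c d X)"
    and "integral\<^sup>L L (\<lambda>X. indicator (face S1 S2) X * log_drift \<eta> A c d X) = 0"
proof -
  have L: "borel_prob L" and prof: "AE X in L. X \<in> profiles" using inv by (auto simp: mwu_invariant_def)
  interpret prob_space L using L by (simp add: borel_prob_def)
  have [measurable_cong]: "sets L = sets borel" using L by (simp add: borel_prob_def)
  obtain C where C: "\<And>X i j. X \<in> profiles \<Longrightarrow> \<bar>log_increment \<eta> A c d X i j\<bar> \<le> C"
    using log_increment_bounded[of \<eta> A c d] by blast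
  define g where "g n X = truncate (real n) (log_potential c d X) * indicator (face S1 S2) X"
    for n and X :: "('a, 'b) profile"
  have [measurable]: "g n \<in> borel_measurable borel" for n unfolding g_def by measurable
  have [measurable]: "log_drift \<eta> A c d \<in> borel_measurable borel"
    unfolding log_drift_def log_increment_def by measurable
  \<comment> \<open>By invariance of the face the indicator is the same before and after the update
    and factors out. Each remaining difference is at most C, uniformly in n, because truncation is
    1-Lipschitz.\<close>
  have eq: "mwu_op \<eta> A (g n) X - g n X = indicator (face S1 S2) X *
      (\<Sum>i\<in>UNIV. \<Sum>j\<in>UNIV. fst X $ i * snd X $ j *
        (truncate n (log_potential c d X + log_increment \<eta> A c d X i j) - truncate n (log_potential c d X)))"
    if X: "X \<in> profiles" for n X
  proof (cases "X \<in> face S1 S2")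
    case True
    then show ?thesis
      unfolding mwu_op_diff[OF X] unfolding g_def
      by (simp add: mwu_update_face[OF X] log_potential_update[OF X True c d])
  next
    case False
    then show ?thesis unfolding mwu_op_diff[OF X] unfolding g_def by (simp add: mwu_update_face[OF X])
  qed
  have lim: "AE X in L. (\<lambda>n. mwu_op \<eta> A (g n) X - g n X) \<longlonglongrightarrow> indicator (face S1 S2) X * log_drift \<eta> A c d X"
    using prof
  proof eventually_elim
    fix X :: "('a, 'b) profile" assume X: "X \<in> profiles"
    have "(\<lambda>n. truncate (real n) (a + b) - truncate (real n) a) \<longlonglongrightarrow> b" for a b
      using tendsto_diff[OF tendsto_truncate tendsto_truncate, of "a + b" a] by simp
    then show "(\<lambda>n. mwu_op \<eta> A (g n) X - g n X) \<longlonglongrightarrow> indicator (face S1 S2) X * log_drift \<eta> A c d X"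
      unfolding eq[OF X] log_drift_def by (intro tendsto_intros)
  qed
  have bdd: "AE X in L. norm (mwu_op \<eta> A (g n) X - g n X) \<le> C" for n
    using prof
  proof eventually_elim
    fix X :: "('a, 'b) profile" assume X: "X \<in> profiles"
    have "\<bar>truncate n (a + log_increment \<eta> A c d X i j) - truncate n a\<bar> \<le> C" for a i j
      using truncate_Lipschitz[of n "a + log_increment \<eta> A c d X i j" a] C[OF X, of i j] by simp
    then have "\<bar>\<Sum>i\<in>UNIV. \<Sum>j\<in>UNIV. fst X $ i * snd X $ j *
        (truncate n (log_potential c d X + log_increment \<eta> A c d X i j) - truncate n (log_potential c d X))\<bar> \<le> C"
      by (intro profile_average_le[OF X])
    moreover have "0 \<le> C" using C[OF X] by (meson abs_ge_zero order_trans)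
    ultimately show "norm (mwu_op \<eta> A (g n) X - g n X) \<le> C"
      unfolding eq[OF X] by (simp add: indicator_def)
  qed
  have "integrable L (\<lambda>_. C)" by simp
  note dc = _ _ this lim bdd
  show "integrable L (\<lambda>X. indicator (face S1 S2) X * log_drift \<eta> A c d X)"
    by (rule integrable_dominated_convergence[OF dc]) measurable
  have "(\<lambda>n. integral\<^sup>L L (\<lambda>X. mwu_op \<eta> A (g n) X - g n X))
      \<longlonglongrightarrow> integral\<^sup>L L (\<lambda>X. indicator (face S1 S2) X * log_drift \<eta> A c d X)"
    by (rule integral_dominated_convergence[OF dc]) measurable
  moreover have "integral\<^sup>L L (\<lambda>X. mwu_op \<eta> A (g n) X - g n X) = 0" for n
    unfolding g_def by (rule truncated_log_drift_integral[OF inv _ c d]) auto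
  ultimately show "integral\<^sup>L L (\<lambda>X. indicator (face S1 S2) X * log_drift \<eta> A c d X) = 0"
    by (simp add: LIMSEQ_const_iff)
qed

text \<open>A nonnegative function with integral 0 vanishes almost everywhere, whereas this one is
  positive on the face.\<close>

lemma AE_not_in_face:
  assumes inv: "mwu_invariant \<eta> A L"
    and c: "\<And>i. i \<notin> S1 \<Longrightarrow> c i = 0" and d: "\<And>j. j \<notin> S2 \<Longrightarrow> d j = 0"
    and pos: "\<And>X :: ('a::finite, 'b::finite) profile. X \<in> profiles \<Longrightarrow> X \<in> face S1 S2 \<Longrightarrow> 0 < log_drift \<eta> A c d X"
  shows "AE X in L. X \<notin> face S1 S2"
proof -
  have prof: "AE X in L. X \<in> profiles" using inv by (auto simp: mwu_invariant_def)
  note I = log_drift_integral[where c = c and d = d, OF inv c d]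
  have "AE X in L. 0 \<le> indicator (face S1 S2) X * log_drift \<eta> A c d X"
    using prof
  proof eventually_elim
    fix X :: "('a, 'b) profile" assume "X \<in> profiles"
    then show "0 \<le> indicator (face S1 S2) X * log_drift \<eta> A c d X"
      using pos[of X] by (cases "X \<in> face S1 S2") (auto intro: less_imp_le)
  qed
  then have "AE X in L. indicator (face S1 S2) X * log_drift \<eta> A c d X = 0"
    using integral_nonneg_eq_0_iff_AE[OF I(1)] I(2) by simp
  with prof show ?thesis
  proof eventually_elim
    fix X :: "('a, 'b) profile"
    assume "X \<in> profiles" "indicator (face S1 S2) X * log_drift \<eta> A c d X = 0"
    then show "X \<notin> face S1 S2" using pos[of X] by auto
  qed
qed

section \<open>Choice of the potential\<close>

text \<open>A Fredholm alternative for signed strategies in the game restricted to S1 and S2.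
  \<open>U\<close> collects the pairs (A q - v on S1, sum of q). If (0, 1) lies in \<open>U\<close>,
  then \<open>q\<close> equalises; otherwise the component of (0, 1) orthogonal to \<open>U\<close>
  provides \<open>c\<close>.\<close>

lemma affine_alternative:
  fixes A :: "'a::finite \<Rightarrow> 'b::finite \<Rightarrow> real"
  shows "(\<exists>c \<kappa>. 0 < \<kappa> \<and> (\<forall>i. i \<notin> S1 \<longrightarrow> c i = 0) \<and> (\<Sum>i\<in>UNIV. c i) = 0 \<and> (\<forall>j\<in>S2. (\<Sum>i\<in>UNIV. c i * A i j) = \<kappa>))
    \<or> (\<exists>q v. (\<forall>j. j \<notin> S2 \<longrightarrow> q j = 0) \<and> (\<Sum>j\<in>UNIV. q j) = 1 \<and> (\<forall>i\<in>S1. (\<Sum>j\<in>UNIV. A i j * q j) = v))"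
proof -
  define F where "F q v = ((\<chi> i. if i \<in> S1 then (\<Sum>j\<in>S2. A i j * q j) - v else 0) :: real^'a, \<Sum>j\<in>S2. q j)"
    for q :: "'b \<Rightarrow> real" and v
  define U where "U = {F q v | q v. True}"
  have add: "F q v + F q' v' = F (\<lambda>j. q j + q' j) (v + v')" for q v q' v'
    by (auto simp: F_def vec_eq_iff sum.distrib distrib_left)
  have scale: "r *\<^sub>R F q v = F (\<lambda>j. r * q j) (r * v)" for r q v
    by (auto simp: F_def vec_eq_iff sum_distrib_left algebra_simps)
  have "0 = F (\<lambda>_. 0) 0" by (auto simp: F_def vec_eq_iff zero_prod_def)
  then have "subspace U"
    unfolding subspace_def U_def using add scale by blast
  then have span: "span U = U" by (simp add: span_eq_iff)
  obtain y z where yz: "y \<in> U" "\<And>w. w \<in> U \<Longrightarrow> z \<bullet> w = 0" "(0, 1) = y + z"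
    using orthogonal_subspace_decomp_exists[of U "(0, 1)"] unfolding span orthogonal_def by metis
  show ?thesis
  proof (cases "z = 0")
    case True
    then obtain q v where qv: "(0, 1) = F q v" using yz by (auto simp: U_def)
    let ?q = "\<lambda>j. if j \<in> S2 then q j else 0"
    have "(\<Sum>j\<in>UNIV. ?q j) = 1" using qv by (simp add: F_def sum.If_cases)
    moreover have "(\<Sum>j\<in>UNIV. A i j * ?q j) = v" if "i \<in> S1" for i
    proof -
      have "(\<Sum>j\<in>UNIV. A i j * ?q j) = (\<Sum>j\<in>S2. A i j * q j)"
        by (simp add: if_distrib sum.If_cases cong: if_cong)
      then show ?thesis using qv that by (auto simp: F_def vec_eq_iff dest: spec[of _ i])
    qed
    ultimately show ?thesis by (intro disjI2 exI[of _ ?q] exI[of _ v]) auto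
  next
    case False
    \<comment> \<open>Since \<open>y\<close> is orthogonal to \<open>z\<close>, the last coordinate
      of \<open>z\<close> is its squared norm; this positive number becomes
      \<open>\<kappa>\<close>.\<close>
    have "z \<bullet> (0, 1) = z \<bullet> z" using yz by (simp add: inner_add_right)
    then have \<kappa>: "0 < snd z" using False by (metis inner_Pair_0(1) inner_gt_zero_iff inner_real_def mult.right_neutral prod.collapse)
    let ?c = "\<lambda>i. if i \<in> S1 then - (fst z $ i) else 0"
    \<comment> \<open>Orthogonality to the direction of \<open>v\<close> makes \<open>?c\<close> sum
      to 0. Orthogonality to the directions of the single \<open>q j\<close>, used next, gives the
      constant payoff.\<close>
    have "z \<bullet> F (\<lambda>_. 0) (-1) = 0" by (rule yz) (auto simp: U_def)
    then have "(\<Sum>i\<in>UNIV. ?c i) = 0"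
      by (cases z) (simp add: F_def inner_vec_def if_distrib sum.If_cases sum_negf cong: if_cong)
    moreover have "(\<Sum>i\<in>UNIV. ?c i * A i j) = snd z" if "j \<in> S2" for j
    proof -
      have "z \<bullet> F (\<lambda>k. of_bool (k = j)) 0 = 0" by (rule yz) (auto simp: U_def)
      moreover have "(\<Sum>i\<in>UNIV. ?c i * A i j) = (\<Sum>i\<in>S1. - (fst z $ i * A i j))"
        by (simp add: if_distrib[where f = "\<lambda>x. x * A _ j"] sum.If_cases cong: if_cong)
      ultimately show ?thesis using that
        by (cases z) (simp add: F_def inner_vec_def if_distrib sum.If_cases sum_negf of_bool_def
            sum.delta cong: if_cong)
    qed
    ultimately show ?thesis using \<kappa> by (intro disjI1 exI[of _ ?c] exI[of _ "snd z"]) auto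
  qed
qed

text \<open>Jensen's inequality via the tangent 1 + w \<le> exp w at w = u t - m, averaged over
  \<open>x\<close>. Equality at a point forces u t = m.\<close>

lemma ln_sum_exp_ge:
  assumes x: "x \<in> mixed_strats"
  shows "(\<Sum>t\<in>UNIV. x $ t * u t) \<le> ln (\<Sum>t\<in>UNIV. x $ t * exp (u t))"
    and "x $ i \<noteq> 0 \<Longrightarrow> x $ j \<noteq> 0 \<Longrightarrow> u i \<noteq> u j \<Longrightarrow>
      (\<Sum>t\<in>UNIV. x $ t * u t) < ln (\<Sum>t\<in>UNIV. x $ t * exp (u t))"
proof -
  define m where "m = (\<Sum>t\<in>UNIV. x $ t * u t)"
  define Z where "Z = (\<Sum>t\<in>UNIV. x $ t * exp (u t))"
  have Z: "0 < Z" unfolding Z_def by (rule mixed_strats_weighted_sum_pos[OF x]) simp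
  have lin: "(\<Sum>t\<in>UNIV. x $ t * (1 + (u t - m))) = 1"
    using mixed_stratsD[OF x]
    by (simp add: distrib_left right_diff_distrib sum.distrib sum_subtractf m_def sum_distrib_right[symmetric])
  have Ze: "Z * exp (- m) = (\<Sum>t\<in>UNIV. x $ t * exp (u t - m))"
    by (simp add: Z_def sum_distrib_right exp_diff exp_minus divide_inverse mult.assoc)
  have term_le: "x $ t * (1 + (u t - m)) \<le> x $ t * exp (u t - m)" for t
    using mixed_stratsD(1)[OF x, of t] exp_ge_add_one_self[of "u t - m"] by (intro mult_left_mono) auto
  have "(\<Sum>t\<in>UNIV. x $ t * (1 + (u t - m))) \<le> (\<Sum>t\<in>UNIV. x $ t * exp (u t - m))"
    by (intro sum_mono term_le)
  then have "1 \<le> Z * exp (- m)" unfolding Ze lin .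
  then have "exp m \<le> Z" by (simp add: exp_minus divide_inverse[symmetric])
  then show "(\<Sum>t\<in>UNIV. x $ t * u t) \<le> ln (\<Sum>t\<in>UNIV. x $ t * exp (u t))"
    using Z unfolding m_def[symmetric] Z_def[symmetric] by (simp add: ln_ge_iff)
  assume ij: "x $ i \<noteq> 0" "x $ j \<noteq> 0" "u i \<noteq> u j"
  \<comment> \<open>Two different values of \<open>u\<close> on the support cannot both equal the
    mean m.\<close>
  obtain t where t: "x $ t \<noteq> 0" "u t \<noteq> m" using ij by metis
  have "1 + (u t - m) < exp (u t - m)"
  proof -
    have "ln (exp (u t - m)) \<noteq> exp (u t - m) - 1"
      using ln_eq_minus_one[of "exp (u t - m)"] t(2) by auto
    then have "u t - m \<noteq> exp (u t - m) - 1" by simp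
    then show ?thesis using exp_ge_add_one_self[of "u t - m"] by linarith
  qed
  then have "x $ t * (1 + (u t - m)) < x $ t * exp (u t - m)"
    using mixed_stratsD(1)[OF x, of t] t by (intro mult_strict_left_mono) auto
  then have "1 < Z * exp (- m)" unfolding Ze
    using sum_strict_mono_ex1[of UNIV "\<lambda>t. x $ t * (1 + (u t - m))" "\<lambda>t. x $ t * exp (u t - m)"]
      term_le lin by auto
  then have "exp m < Z" by (simp add: exp_minus divide_inverse[symmetric])
  then show "(\<Sum>t\<in>UNIV. x $ t * u t) < ln (\<Sum>t\<in>UNIV. x $ t * exp (u t))"
    using Z unfolding m_def[symmetric] Z_def[symmetric] by (metis exp_gt_zero ln_exp ln_less_cancel_iff)
qed

section \<open>Positive drift on nontrivial faces\<close>

lemma profile_average_pos: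
  assumes X: "X \<in> profiles" "X \<in> face S1 S2"
    and u: "\<And>i j. i \<in> S1 \<Longrightarrow> j \<in> S2 \<Longrightarrow> 0 < u i j"
  shows "0 < (\<Sum>i\<in>UNIV. \<Sum>j\<in>UNIV. fst X $ i * snd X $ j * u i j)"
proof -
  have term_ge: "0 \<le> fst X $ i * snd X $ j * u i j" for i j
  proof (cases "i \<in> S1 \<and> j \<in> S2")
    case True
    then show ?thesis using u[of i j] profilesD[OF X(1)] by (intro mult_nonneg_nonneg) auto
  next
    case False
    then have "fst X $ i = 0 \<or> snd X $ j = 0" using X(2) by (auto simp: face_def)
    then show ?thesis by auto
  qed
  obtain i where i: "fst X $ i \<noteq> 0"
    using profilesD(5)[OF X(1)] by (metis sum.neutral zero_neq_one)
  obtain j where j: "snd X $ j \<noteq> 0"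
    using profilesD(6)[OF X(1)] by (metis sum.neutral zero_neq_one)
  have "i \<in> S1" "j \<in> S2" using X(2) i j by (auto simp: face_def)
  moreover have "0 < fst X $ i" "0 < snd X $ j"
    using i j profilesD(3)[OF X(1), of i] profilesD(4)[OF X(1), of j] by auto
  ultimately have "0 < fst X $ i * snd X $ j * u i j" using u by simp
  then have "0 < (\<Sum>j\<in>UNIV. fst X $ i * snd X $ j * u i j)"
    using term_ge by (intro sum_pos2[where i = j]) auto
  then show ?thesis
    using term_ge by (intro sum_pos2[where i = i]) (auto intro: sum_nonneg)
qed

lemma face_weight_cong:
  assumes "X \<in> face S1 S2" "\<And>i j. i \<in> S1 \<Longrightarrow> j \<in> S2 \<Longrightarrow> u i j = v i j"
  shows "(\<Sum>i\<in>UNIV. \<Sum>j\<in>UNIV. fst X $ i * snd X $ j * u i j)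
    = (\<Sum>i\<in>UNIV. \<Sum>j\<in>UNIV. fst X $ i * snd X $ j * v i j)"
proof (intro sum.cong refl)
  fix i j
  show "fst X $ i * snd X $ j * u i j = fst X $ i * snd X $ j * v i j"
    using assms by (cases "i \<in> S1"; cases "j \<in> S2") (auto simp: face_def)
qed

lemma sum_weight_indep:
  "(\<Sum>i\<in>UNIV. \<Sum>j\<in>UNIV. x i * y j * (u j :: real)) = (\<Sum>i\<in>UNIV. x i) * (\<Sum>j\<in>UNIV. y j * u j)"
  by (simp add: sum_product mult.assoc)

text \<open>The first-order parts of the two logarithmic normalisers cancel because the game is
  zero-sum; distinctness of the entries makes one of the two Jensen inequalities strict.\<close>
lemma log_normaliser_average_pos:
  fixes A :: "'a::finite \<Rightarrow> 'b::finite \<Rightarrow> real"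
  assumes distinct: "\<And>i j k l. A i j = A k l \<Longrightarrow> i = k \<and> j = l"
    and \<eta>: "0 < \<eta>" and X: "X \<in> profiles" "X \<in> face S1 S2"
    and nontriv: "\<not> (\<exists>i j. S1 = {i} \<and> S2 = {j})"
  shows "0 < (\<Sum>i\<in>UNIV. \<Sum>j\<in>UNIV. fst X $ i * snd X $ j * (ln (normaliser1 \<eta> A X j) + ln (normaliser2 \<eta> A X i)))"
proof -
  define m1 where "m1 j = (\<Sum>t\<in>UNIV. fst X $ t * (\<eta> * A t j))" for j
  define m2 where "m2 i = (\<Sum>t\<in>UNIV. snd X $ t * (\<eta> * (- A i t)))" for i
  note x = profilesD(1)[OF X(1)] and y = profilesD(2)[OF X(1)]
  have supp: "fst X $ i \<noteq> 0 \<longleftrightarrow> i \<in> S1" "snd X $ j \<noteq> 0 \<longleftrightarrow> j \<in> S2" for i j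
    using X(2) by (auto simp: face_def)
  have swap: "(\<Sum>i\<in>UNIV. \<Sum>j\<in>UNIV. fst X $ i * snd X $ j * m2 i)
      = (\<Sum>j\<in>UNIV. \<Sum>i\<in>UNIV. snd X $ j * fst X $ i * m2 i)"
    by (subst sum.swap) (simp add: mult.commute)
  have "(\<Sum>i\<in>UNIV. \<Sum>j\<in>UNIV. fst X $ i * snd X $ j * (m1 j + m2 i))
      = (\<Sum>i\<in>UNIV. \<Sum>j\<in>UNIV. fst X $ i * snd X $ j * m1 j)
      + (\<Sum>j\<in>UNIV. \<Sum>i\<in>UNIV. snd X $ j * fst X $ i * m2 i)"
    unfolding swap[symmetric] by (simp add: distrib_left sum.distrib)
  also have "\<dots> = (\<Sum>j\<in>UNIV. snd X $ j * m1 j) + (\<Sum>i\<in>UNIV. fst X $ i * m2 i)"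
    unfolding sum_weight_indep using profilesD[OF X(1)] by simp
  also have "\<dots> = 0"
    unfolding m1_def m2_def sum_distrib_left
    by (subst sum.swap) (simp add: sum.distrib[symmetric] algebra_simps)
  finally have zero: "(\<Sum>i\<in>UNIV. \<Sum>j\<in>UNIV. fst X $ i * snd X $ j * (m1 j + m2 i)) = 0" .
  have strict: "m1 j + m2 i < ln (normaliser1 \<eta> A X j) + ln (normaliser2 \<eta> A X i)" if ij: "i \<in> S1" "j \<in> S2" for i j
  proof -
    have le: "m1 j \<le> ln (normaliser1 \<eta> A X j)" "m2 i \<le> ln (normaliser2 \<eta> A X i)"
      unfolding m1_def m2_def by (rule ln_sum_exp_ge(1)[OF x] ln_sum_exp_ge(1)[OF y])+
    \<comment> \<open>Some agent has a second strategy in the face. Distinct entries give it two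
      different payoffs against the sampled opponent strategy, so Jensen is strict for that
      agent.\<close>
    consider k where "k \<in> S1" "k \<noteq> i" | k where "k \<in> S2" "k \<noteq> j"
      using nontriv ij by blast
    then show ?thesis
    proof cases
      case 1
      then have "\<eta> * A i j \<noteq> \<eta> * A k j" using distinct[of i j k j] \<eta> by auto
      then have "m1 j < ln (normaliser1 \<eta> A X j)"
        unfolding m1_def using ln_sum_exp_ge(2)[OF x, of i k "\<lambda>t. \<eta> * A t j"] 1 ij supp by auto
      then show ?thesis using le by linarith
    next
      case 2
      then have "\<eta> * (- A i j) \<noteq> \<eta> * (- A i k)" using distinct[of i j i k] \<eta> by auto
      then have "m2 i < ln (normaliser2 \<eta> A X i)"
        unfolding m2_def using ln_sum_exp_ge(2)[OF y, of j k "\<lambda>t. \<eta> * (- A i t)"] 2 ij supp by auto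
      then show ?thesis using le by linarith
    qed
  qed
  have "0 < (\<Sum>i\<in>UNIV. \<Sum>j\<in>UNIV. fst X $ i * snd X $ j *
      (ln (normaliser1 \<eta> A X j) + ln (normaliser2 \<eta> A X i) - (m1 j + m2 i)))"
    by (rule profile_average_pos[OF X]) (use strict in force)
  then show ?thesis
    using zero by (simp add: right_diff_distrib sum_subtractf)
qed

lemma AE_not_in_nontrivial_face:
  fixes A :: "'a::finite \<Rightarrow> 'b::finite \<Rightarrow> real"
  assumes distinct: "\<And>i j k l. A i j = A k l \<Longrightarrow> i = k \<and> j = l"
    and \<eta>: "0 < \<eta>" and inv: "mwu_invariant \<eta> A L"
    and nontriv: "\<not> (\<exists>i j. S1 = {i} \<and> S2 = {j})"
  shows "AE X in L. X \<notin> face S1 S2"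
proof -
  \<comment> \<open>The alternative is applied to A and to its negative transpose. Each application
    yields a growth direction for one agent or an equalising strategy for the other, so without
    growth directions both equalising strategies exist.\<close>
  consider
    (first) c \<kappa> where "0 < \<kappa>" "\<forall>i. i \<notin> S1 \<longrightarrow> c i = 0" "(\<Sum>i\<in>UNIV. c i) = 0"
      "\<forall>j\<in>S2. (\<Sum>i\<in>UNIV. c i * A i j) = \<kappa>"
  | (second) d \<kappa> where "0 < \<kappa>" "\<forall>j. j \<notin> S2 \<longrightarrow> d j = 0" "(\<Sum>j\<in>UNIV. d j) = 0"
      "\<forall>i\<in>S1. (\<Sum>j\<in>UNIV. d j * - A i j) = \<kappa>"
  | (equalising) p q v w where "\<forall>i. i \<notin> S1 \<longrightarrow> p i = 0" "(\<Sum>i\<in>UNIV. p i) = 1"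
      "\<forall>j\<in>S2. (\<Sum>i\<in>UNIV. - A i j * p i) = v"
      "\<forall>j. j \<notin> S2 \<longrightarrow> q j = 0" "(\<Sum>j\<in>UNIV. q j) = 1"
      "\<forall>i\<in>S1. (\<Sum>j\<in>UNIV. A i j * q j) = w"
    using affine_alternative[of S1 S2 A] affine_alternative[of S2 S1 "\<lambda>j i. - A i j"]
    by (elim disjE exE conjE) blast+
  then show ?thesis
  proof cases
    case first
    have inc: "log_increment \<eta> A c (\<lambda>_. 0) X i j = \<eta> * \<kappa>" if "j \<in> S2" for X i j
    proof -
      have "log_increment \<eta> A c (\<lambda>_. 0) X i j
          = \<eta> * (\<Sum>s\<in>UNIV. c s * A s j) - (\<Sum>s\<in>UNIV. c s) * ln (normaliser1 \<eta> A X j)"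
        by (simp add: log_increment_def right_diff_distrib sum_subtractf sum_distrib_left
            sum_distrib_right mult.left_commute)
      then show ?thesis using first that by simp
    qed
    show ?thesis
    proof (rule AE_not_in_face[OF inv])
      fix X :: "('a, 'b) profile" assume X: "X \<in> profiles" "X \<in> face S1 S2"
      show "0 < log_drift \<eta> A c (\<lambda>_. 0) X"
        unfolding log_drift_def using first(1) \<eta> inc by (intro profile_average_pos[OF X]) auto
    qed (use first in auto)
  next
    case second
    have inc: "log_increment \<eta> A (\<lambda>_. 0) d X i j = \<eta> * \<kappa>" if "i \<in> S1" for X i j
    proof -
      have "log_increment \<eta> A (\<lambda>_. 0) d X i j
          = \<eta> * (\<Sum>s\<in>UNIV. d s * - A i s) - (\<Sum>s\<in>UNIV. d s) * ln (normaliser2 \<eta> A X i)"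
        by (simp add: log_increment_def right_diff_distrib sum_subtractf sum_distrib_left
            sum_distrib_right mult.left_commute)
      then show ?thesis using second that by simp
    qed
    show ?thesis
    proof (rule AE_not_in_face[OF inv])
      fix X :: "('a, 'b) profile" assume X: "X \<in> profiles" "X \<in> face S1 S2"
      show "0 < log_drift \<eta> A (\<lambda>_. 0) d X"
        unfolding log_drift_def using second(1) \<eta> inc by (intro profile_average_pos[OF X]) auto
    qed (use second in auto)
  next
    case equalising
    \<comment> \<open>Evaluating p A q by rows gives w and by columns gives -v, the sign coming from
      the negated matrix. Hence the two constant payoffs cancel in the increment.\<close>
    have "w = (\<Sum>i\<in>UNIV. p i * (\<Sum>j\<in>UNIV. A i j * q j))"
    proof -
      have "(\<Sum>i\<in>UNIV. p i * (\<Sum>j\<in>UNIV. A i j * q j)) = (\<Sum>i\<in>UNIV. p i * w)"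
        using equalising by (intro sum.cong refl) (metis mult_eq_0_iff)
      then show ?thesis using equalising(2) by (simp add: sum_distrib_right[symmetric])
    qed
    also have "\<dots> = (\<Sum>j\<in>UNIV. q j * - (\<Sum>i\<in>UNIV. - A i j * p i))"
      unfolding sum_distrib_left sum_negf[symmetric]
      by (subst sum.swap) (simp add: algebra_simps)
    also have "\<dots> = (\<Sum>j\<in>UNIV. q j * - v)"
      using equalising by (intro sum.cong refl) (metis mult_eq_0_iff)
    also have "\<dots> = - v"
      using equalising(5) by (simp add: sum_negf sum_distrib_right[symmetric])
    finally have w: "w = - v" .
    let ?c = "\<lambda>i. - p i" and ?d = "\<lambda>j. - q j"
    have inc: "log_increment \<eta> A ?c ?d X i j = ln (normaliser1 \<eta> A X j) + ln (normaliser2 \<eta> A X i)"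
      if "i \<in> S1" "j \<in> S2" for X i j
    proof -
      have "log_increment \<eta> A ?c ?d X i j
          = \<eta> * (\<Sum>s\<in>UNIV. - A s j * p s) + (\<Sum>s\<in>UNIV. p s) * ln (normaliser1 \<eta> A X j)
          + \<eta> * (\<Sum>s\<in>UNIV. A i s * q s) + (\<Sum>s\<in>UNIV. q s) * ln (normaliser2 \<eta> A X i)"
        unfolding log_increment_def sum_distrib_left sum_distrib_right sum.distrib[symmetric]
          add.assoc
        by (simp add: algebra_simps sum.distrib sum_subtractf sum_negf)
      then show ?thesis using equalising w that by simp
    qed
    show ?thesis
    proof (rule AE_not_in_face[OF inv])
      fix X :: "('a, 'b) profile" assume X: "X \<in> profiles" "X \<in> face S1 S2"
      have "log_drift \<eta> A ?c ?d X = (\<Sum>i\<in>UNIV. \<Sum>j\<in>UNIV. fst X $ i * snd X $ j *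
          (ln (normaliser1 \<eta> A X j) + ln (normaliser2 \<eta> A X i)))"
        unfolding log_drift_def by (intro face_weight_cong[OF X(2)] inc)
      then show "0 < log_drift \<eta> A ?c ?d X"
        using log_normaliser_average_pos[OF distinct \<eta> X nontriv] by simp
    qed (use equalising in auto)
  qed
qed

section \<open>Vertices of the profile space and conclusion\<close>

lemma mixed_strats_eq_axis:
  assumes "x \<in> mixed_strats" "\<And>s. x $ s \<noteq> 0 \<longleftrightarrow> s = k"
  shows "x = axis k 1"
proof -
  have "(\<Sum>s\<in>UNIV. x $ s) = (\<Sum>s\<in>UNIV. if s = k then x $ k else 0)"
    using assms(2) by (intro sum.cong) auto
  then have "x $ k = 1" using mixed_stratsD(2)[OF assms(1)] by simp
  then show ?thesis using assms(2) by (auto simp: vec_eq_iff axis_def)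
qed

lemma trivial_face_pure:
  assumes "X \<in> profiles" "X \<in> face {i} {j}"
  shows "X \<in> pure_profiles"
proof -
  have "fst X = axis i 1" "snd X = axis j 1"
    using assms profilesD[OF assms(1)] by (auto intro!: mixed_strats_eq_axis simp: face_def)
  then show ?thesis
    unfolding pure_profiles_def by (cases X) auto
qed

theorem theorem5:
  fixes A :: "'a::finite \<Rightarrow> 'b::finite \<Rightarrow> real"
  assumes distinct: "\<And>i j k l. A i j = A k l \<Longrightarrow> i = k \<and> j = l"
  shows "\<exists>\<eta>0 > 0. \<forall>\<eta>. 0 < \<eta> \<and> \<eta> < \<eta>0 \<longrightarrow>
           (\<forall>X0 \<in> profiles.
              (\<exists>r L. strict_mono r \<and> borel_prob L \<and>
                  weakly_conv_to (\<lambda>n. measure_pmf (smwu_avg \<eta> A X0 (Suc (r n)))) L)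
            \<and> (\<forall>r L. strict_mono r \<longrightarrow> borel_prob L \<longrightarrow>
                  weakly_conv_to (\<lambda>n. measure_pmf (smwu_avg \<eta> A X0 (Suc (r n)))) L \<longrightarrow>
                  measure L pure_profiles = 1))"
\<comment> \<open>The witness 1 is a free choice: the sign of the drift is controlled at every
  positive learning rate.\<close>
proof (intro exI[of _ 1] conjI allI impI ballI)
  fix \<eta> :: real and X0 :: "('a, 'b) profile"
  assume X0: "X0 \<in> profiles"
  show "\<exists>r L. strict_mono r \<and> borel_prob L \<and>
      weakly_conv_to (\<lambda>n. measure_pmf (smwu_avg \<eta> A X0 (Suc (r n)))) L"
    using set_smwu_avg[OF X0] profiles_subset_cbox
    by (intro weakly_conv_subseq_cube[where \<mu> = "\<lambda>n. smwu_avg \<eta> A X0 (Suc n)"]) blast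
next
  fix \<eta> :: real and X0 :: "('a, 'b) profile" and r L
  assume \<eta>: "0 < \<eta> \<and> \<eta> < 1" and X0: "X0 \<in> profiles" and r: "strict_mono r" and L: "borel_prob L"
    and conv: "weakly_conv_to (\<lambda>n. measure_pmf (smwu_avg \<eta> A X0 (Suc (r n)))) L"
  have inv: "mwu_invariant \<eta> A L" by (rule mwu_invariant_limit[OF X0 r L conv])
  interpret prob_space L using L by (simp add: borel_prob_def)
  \<comment> \<open>There are finitely many support pairs, so the exceptional null sets can be
    united. Each profile lies in the face of its own supports, which must then be a vertex.\<close>
  have "AE X in L. \<forall>S\<in>{S. \<not> (\<exists>i j. fst S = {i} \<and> snd S = {j})}. X \<notin> face (fst S) (snd S)"
    using \<eta> by (intro AE_finite_allI AE_not_in_nontrivial_face[OF distinct _ inv]) auto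
  moreover have "AE X in L. X \<in> profiles" using inv by (simp add: mwu_invariant_def)
  ultimately have "AE X in L. X \<in> pure_profiles"
  proof eventually_elim
    fix X :: "('a, 'b) profile"
    assume faces: "\<forall>S\<in>{S. \<not> (\<exists>i j. fst S = {i} \<and> snd S = {j})}. X \<notin> face (fst S) (snd S)"
      and X: "X \<in> profiles"
    define S1 where "S1 = {i. fst X $ i \<noteq> 0}"
    define S2 where "S2 = {j. snd X $ j \<noteq> 0}"
    have "X \<in> face S1 S2" by (simp add: face_def S1_def S2_def)
    moreover from this obtain i j where "S1 = {i}" "S2 = {j}"
      using bspec[OF faces, of "(S1, S2)"] by auto
    ultimately show "X \<in> pure_profiles" using trivial_face_pure[OF X] by simp
  qed
  moreover have "finite (pure_profiles :: ('a, 'b) profile set)"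
  proof -
    have "pure_profiles = range (\<lambda>(s1, s2). (axis s1 1, axis s2 1) :: ('a, 'b) profile)"
      by (auto simp: pure_profiles_def)
    then show ?thesis by (metis finite finite_imageI)
  qed
  then have "pure_profiles \<in> sets L" using L by (simp add: borel_prob_def borel_closed finite_imp_closed)
  ultimately show "measure L pure_profiles = 1" by (simp add: prob_eq_1)
qed simp

end
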